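(* There is a polynomial-time learning-augmented $O(\log\eta)$-competitive online algorithm for online Steiner tree.
   Context: Online Steiner tree: given an edge-weighted graph $G=(V,E)$ with nonnegative edge weights, terminals arrive one by one and the algorithm must irrevocably buy edges so that after each arrival the bought edges connect all terminals arrived so far; the cost is the total weight of bought edges. A learning-augmented algorithm receives beforehand a predicted set $\hat{X}$ of terminals; with $X$ the actually arriving terminals, the prediction error is $\eta:=\min(|X|,|(X\setminus\hat{X})\cup(\hat{X}\setminus X)|)$. Competitive ratio $\rho$: the cost is always at most $\rho$ times the minimum cost of a subgraph connecting $X$. *)

theory Defs
  imports Complex_Main "HOL-Library.Landau_Symbols" "HOL-Computational_Algebra.Polynomial"
begin

section \<open>A random access machine with real registers\<close>

text \<open>
  Programs of a small imperative language. Memory consists of named two-dimensional arrays with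
  direct and indirect addressing, one kind holding natural numbers and one kind holding reals; a
  scalar is the cell with both indices 0. Arithmetic is restricted as follows.

  \<^item> There is no multiplication, so that counting one unit per command is, up to a polynomial,
    the same as Turing machine time: the bit lengths of all numbers grow by at most a constant
    in every step.
  \<^item> Reals can only be copied, added, subtracted and compared, and there is no real constant
    except 0. In particular a program cannot carry advice in the digits of a constant, and a
    program that is polynomial here is polynomial in the bit model when all the weights are
    rational.
\<close>

datatype nexp =
    Num nat
  | Cell string nexp nexp
  | Add nexp nexp
  | Sub nexp nexp

datatype rexp =
    RZero
  | RCell string nexp nexp
  | RAdd rexp rexp
  | RSub rexp rexp

datatype bexp =
    NLess nexp nexp
  | RLess rexp rexp
  | BNot bexp
  | BAnd bexp bexp

datatype com =
    Skip
  | NAssign string nexp nexp nexp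
  | RAssign string nexp nexp rexp
  | Seq com com
  | If bexp com com
  | While bexp com

record state =
  nmem :: "string \<Rightarrow> nat \<Rightarrow> nat \<Rightarrow> nat"
  rmem :: "string \<Rightarrow> nat \<Rightarrow> nat \<Rightarrow> real"

fun nval :: "nexp \<Rightarrow> state \<Rightarrow> nat" where
  "nval (Num k) s = k"
| "nval (Cell a i j) s = nmem s a (nval i s) (nval j s)"
| "nval (Add e f) s = nval e s + nval f s"
| "nval (Sub e f) s = nval e s - nval f s"

fun rval :: "rexp \<Rightarrow> state \<Rightarrow> real" where
  "rval RZero s = 0"
| "rval (RCell a i j) s = rmem s a (nval i s) (nval j s)"
| "rval (RAdd e f) s = rval e s + rval f s"
| "rval (RSub e f) s = rval e s - rval f s"

fun bval :: "bexp \<Rightarrow> state \<Rightarrow> bool" where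
  "bval (NLess e f) s \<longleftrightarrow> nval e s < nval f s"
| "bval (RLess e f) s \<longleftrightarrow> rval e s < rval f s"
| "bval (BNot b) s \<longleftrightarrow> \<not> bval b s"
| "bval (BAnd b c) s \<longleftrightarrow> bval b s \<and> bval c s"

definition upd :: "(string \<Rightarrow> nat \<Rightarrow> nat \<Rightarrow> 'a) \<Rightarrow> string \<Rightarrow> nat \<Rightarrow> nat \<Rightarrow> 'a \<Rightarrow>
    string \<Rightarrow> nat \<Rightarrow> nat \<Rightarrow> 'a" where
  "upd m a i j x = m(a := (m a)(i := (m a i)(j := x)))"

text \<open>
  \<open>exec c s t s'\<close>: started in \<open>s\<close>, the program \<open>c\<close> halts in \<open>s'\<close> after \<open>t\<close> steps. Expressions
  are charged to the command in which they occur; as they are part of the fixed program, this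
  changes running times by a constant factor only.
\<close>

inductive exec :: "com \<Rightarrow> state \<Rightarrow> nat \<Rightarrow> state \<Rightarrow> bool" where
  Skip: "exec Skip s 1 s"
| NAssign: "exec (NAssign a i j e) s 1
    (s\<lparr>nmem := upd (nmem s) a (nval i s) (nval j s) (nval e s)\<rparr>)"
| RAssign: "exec (RAssign a i j e) s 1
    (s\<lparr>rmem := upd (rmem s) a (nval i s) (nval j s) (rval e s)\<rparr>)"
| Seq: "exec c s t s' \<Longrightarrow> exec d s' t' s'' \<Longrightarrow> exec (Seq c d) s (1 + t + t') s''"
| IfTrue: "bval b s \<Longrightarrow> exec c s t s' \<Longrightarrow> exec (If b c d) s (1 + t) s'"
| IfFalse: "\<not> bval b s \<Longrightarrow> exec d s t s' \<Longrightarrow> exec (If b c d) s (1 + t) s'"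
| WhileFalse: "\<not> bval b s \<Longrightarrow> exec (While b c) s 1 s"
| WhileTrue: "bval b s \<Longrightarrow> exec c s t s' \<Longrightarrow> exec (While b c) s' t' s'' \<Longrightarrow>
    exec (While b c) s (1 + t + t') s''"

lemma exec_deterministic:
  assumes "exec c s t s'" and "exec c s u s''"
  shows "u = t \<and> s'' = s'"
  using assms
proof (induction arbitrary: u s'' rule: exec.induct)
  case (Seq c s t s' d t' s2)
  from Seq.prems show ?case
    by (cases rule: exec.cases) (use Seq.IH in blast)+
next
  case (IfTrue b s c t s' d)
  from IfTrue.prems show ?case
    by (cases rule: exec.cases) (use IfTrue.IH IfTrue.hyps in blast)+
next
  case (IfFalse b s d t s' c)
  from IfFalse.prems show ?case
    by (cases rule: exec.cases) (use IfFalse.IH IfFalse.hyps in blast)+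
next
  case (WhileTrue b s c t s' t' s2)
  from WhileTrue.prems show ?case
    by (cases rule: exec.cases) (use WhileTrue.IH WhileTrue.hyps in blast)+
qed (erule exec.cases; simp)+

section \<open>Online Steiner tree\<close>

text \<open>
  Graphs are finite, undirected and simple. So that they can be handed to a program, the vertices
  are the numbers below \<open>n\<close>.
\<close>

definition weighted_graph :: "nat \<Rightarrow> nat set set \<Rightarrow> (nat set \<Rightarrow> real) \<Rightarrow> bool" where
  "weighted_graph n E w \<longleftrightarrow>
     (\<forall>e\<in>E. e \<subseteq> {..<n} \<and> card e = 2) \<and> (\<forall>e\<in>E. 0 \<le> w e)"

definition connects :: "nat set set \<Rightarrow> nat set \<Rightarrow> bool" where
  "connects F X \<longleftrightarrow> (\<forall>u\<in>X. \<forall>v\<in>X. (u, v) \<in> {(a, b). {a, b} \<in> F}\<^sup>*)"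

definition steiner_opt :: "nat set set \<Rightarrow> (nat set \<Rightarrow> real) \<Rightarrow> nat set \<Rightarrow> real" where
  "steiner_opt E w X = Min {sum w F | F. F \<subseteq> E \<and> connects F X}"

definition prediction_error :: "nat set \<Rightarrow> nat set \<Rightarrow> nat" where
  "prediction_error X Xhat = min (card X) (card ((X - Xhat) \<union> (Xhat - X)))"

text \<open>
  The list \<open>xs\<close> holds the terminals in the order of their arrival. The graph need not be
  connected, but the arriving terminals lie in one component: otherwise there is no solution.
\<close>

definition steiner_instance ::
    "nat \<Rightarrow> nat set set \<Rightarrow> (nat set \<Rightarrow> real) \<Rightarrow> nat set \<Rightarrow> nat list \<Rightarrow> bool" where
  "steiner_instance n E w Xhat xs \<longleftrightarrow>
     weighted_graph n E w \<and> Xhat \<subseteq> {..<n} \<and> set xs \<subseteq> {..<n} \<and> connects E (set xs)"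

section \<open>Learning-augmented online algorithms\<close>

text \<open>
  An algorithm is a pair of programs. The first one is run once, on the graph (as adjacency and
  weight matrices) and the prediction (as a characteristic vector). The second one is run at each
  arrival on the memory left by the previous run, with the new terminal in the scalar \<open>req\<close>.
\<close>

type_synonym online_alg = "com \<times> com"

definition input_state :: "nat \<Rightarrow> nat set set \<Rightarrow> (nat set \<Rightarrow> real) \<Rightarrow> nat set \<Rightarrow> state" where
  "input_state n E w Xhat = \<lparr>
     nmem = (\<lambda>a i j.
       if a = ''n'' \<and> i = 0 \<and> j = 0 then n
       else if a = ''adj'' \<and> {i, j} \<in> E then 1
       else if a = ''pred'' \<and> i \<in> Xhat \<and> j = 0 then 1
       else 0),
     rmem = (\<lambda>a i j. if a = ''w'' \<and> {i, j} \<in> E then w {i, j} else 0)\<rparr>"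

definition arrive :: "nat \<Rightarrow> state \<Rightarrow> state" where
  "arrive x s = s\<lparr>nmem := upd (nmem s) ''req'' 0 0 x\<rparr>"

definition purchase :: "state \<Rightarrow> nat set set" where
  "purchase s = {{u, v} | u v. nmem s ''buy'' u v \<noteq> 0}"

text \<open>
  \<open>serve c s xs t Fs\<close>: serving \<open>xs\<close> from memory \<open>s\<close> takes \<open>t\<close> steps in total, and \<open>Fs ! i\<close> are
  the edges ordered at the \<open>i\<close>-th arrival. What is owned at any time is the union of all orders so
  far, so that purchases are irrevocable; ordering an edge again is free.
\<close>

inductive serve :: "com \<Rightarrow> state \<Rightarrow> nat list \<Rightarrow> nat \<Rightarrow> nat set set list \<Rightarrow> bool" for c where
  Nil: "serve c s [] 0 []"
| Cons: "exec c (arrive x s) t s' \<Longrightarrow> serve c s' xs t' Fs \<Longrightarrow>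
    serve c s (x # xs) (t + t') (purchase s' # Fs)"

definition online_run :: "online_alg \<Rightarrow> nat \<Rightarrow> nat set set \<Rightarrow> (nat set \<Rightarrow> real) \<Rightarrow> nat set \<Rightarrow>
    nat list \<Rightarrow> nat \<Rightarrow> nat set set list \<Rightarrow> bool" where
  "online_run A n E w Xhat xs T Fs \<longleftrightarrow>
     (\<exists>s t t'. exec (fst A) (input_state n E w Xhat) t s \<and> serve (snd A) s xs t' Fs \<and>
        T = t + t')"

lemma serve_deterministic:
  assumes "serve c s xs t Fs" and "serve c s xs u Gs"
  shows "u = t \<and> Gs = Fs"
  using assms
proof (induction arbitrary: u Gs rule: serve.induct)
  case (Nil s)
  then show ?case by (auto elim: serve.cases)
next
  case (Cons x s t s' xs t' Fs)
  from Cons.prems obtain t2 s2 u2 Gs2 where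
    *: "exec c (arrive x s) t2 s2" "serve c s2 xs u2 Gs2" "u = t2 + u2" "Gs = purchase s2 # Gs2"
    by (auto elim: serve.cases)
  with Cons.hyps(1) have "t2 = t" "s2 = s'" using exec_deterministic by blast+
  with * Cons.IH show ?case by blast
qed

lemma online_run_deterministic:
  assumes "online_run A n E w Xhat xs T Fs" and "online_run A n E w Xhat xs U Gs"
  shows "U = T \<and> Gs = Fs"
  using assms exec_deterministic serve_deterministic unfolding online_run_def by metis

definition polynomial_time :: "online_alg \<Rightarrow> bool" where
  "polynomial_time A \<longleftrightarrow>
     (\<exists>p :: nat poly. \<forall>n E w Xhat xs. steiner_instance n E w Xhat xs \<longrightarrow>
        (\<exists>T Fs. online_run A n E w Xhat xs T Fs \<and> T \<le> poly p (n + length xs)))"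

definition feasible_purchases :: "nat set set \<Rightarrow> nat list \<Rightarrow> nat set set list \<Rightarrow> bool" where
  "feasible_purchases E xs Fs \<longleftrightarrow>
     (\<forall>F\<in>set Fs. F \<subseteq> E) \<and>
     (\<forall>i\<le>length xs. connects (\<Union> (set (take i Fs))) (set (take i xs)))"

text \<open>The competitive ratio is a function of the prediction error.\<close>

definition competitive :: "online_alg \<Rightarrow> (nat \<Rightarrow> real) \<Rightarrow> bool" where
  "competitive A \<rho> \<longleftrightarrow>
     (\<forall>n E w Xhat xs. steiner_instance n E w Xhat xs \<longrightarrow>
        (\<exists>T Fs. online_run A n E w Xhat xs T Fs \<and> feasible_purchases E xs Fs \<and>
           sum w (\<Union> (set Fs))
             \<le> \<rho> (prediction_error (set xs) Xhat) * steiner_opt E w (set xs)))"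

end

theory Submission
  imports Defs "HOL-Real_Asymp.Real_Asymp"
begin

text \<open>
  The algorithm keeps a partition of the vertices into classes, at first singletons, each connected
  by bought edges. A new terminal \<open>x\<close> first buys a shortest path from its class to an earlier
  terminal, at greedy cost \<open>g x\<close>. If \<open>x\<close> is predicted, it then spends at most \<open>g x\<close> more on letting
  its class grow: again and again the nearest predicted vertex outside the class is bought and the
  two classes are merged, until that distance is at least the remaining budget. So the total cost
  is at most twice the sum of the greedy costs.

  Let \<open>D\<close> be the size of the symmetric difference of the terminals and the prediction, and truncate
  all distances at \<open>\<delta> = OPT / (D + 1)\<close>. The classes merge as in Boruvka's algorithm, so the truncated
  merging costs are bounded by a minimum spanning tree of the prediction for the truncated metric,
  which costs at most \<open>2 OPT + D \<delta>\<close>: tour an optimal Steiner tree and attach every superfluous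
  vertex at cost \<open>\<delta>\<close>. The budget that a class could not spend is less than its distance to the
  nearest other class; these distances are paid for by later merges or, at the end, by the
  spanning tree. Hence the truncated greedy costs sum up to \<open>O(OPT)\<close>. Terminals of greedy cost at
  least \<open>\<theta>\<close> have pairwise distances at least \<open>\<theta>\<close>, so there are at most \<open>1 + 2 OPT / \<theta>\<close> of them; in
  particular only \<open>O(D)\<close> terminals exceed \<open>\<delta>\<close>, and these cost \<open>O(log D) OPT\<close> by a harmonic sum. The
  harmonic sum over all terminals gives the bound \<open>O(log |X|) OPT\<close>.
\<close>

section \<open>Connectivity and tours\<close>

text \<open>The relation inside \<open>connects\<close>. It is reflexive on every vertex, so
  singletons are connected by the empty edge set; the first arrival and singleton classes rely on
  this.\<close>

definition conn :: "'a set set \<Rightarrow> 'a rel" where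
  "conn F = {(a, b). {a, b} \<in> F}\<^sup>*"

lemma connects_conn: "connects F X \<longleftrightarrow> (\<forall>u\<in>X. \<forall>v\<in>X. (u, v) \<in> conn F)"
  by (simp add: connects_def conn_def)

lemma conn_refl [simp]: "(a, a) \<in> conn F"
  by (simp add: conn_def)

lemma conn_trans: "(a, b) \<in> conn F \<Longrightarrow> (b, c) \<in> conn F \<Longrightarrow> (a, c) \<in> conn F"
  unfolding conn_def by (rule rtrancl_trans)

lemma conn_sym: "(a, b) \<in> conn F \<Longrightarrow> (b, a) \<in> conn F"
proof -
  have "sym {(a, b). {a, b} \<in> F}" by (auto simp: sym_def insert_commute)
  then show "(a, b) \<in> conn F \<Longrightarrow> (b, a) \<in> conn F"
    unfolding conn_def by (meson sym_rtrancl symD)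
qed

lemma conn_mono: "(a, b) \<in> conn F \<Longrightarrow> F \<subseteq> F' \<Longrightarrow> (a, b) \<in> conn F'"
  unfolding conn_def by (erule rtrancl_mono[THEN subsetD, rotated]) auto

lemma conn_edge: "{a, b} \<in> F \<Longrightarrow> (a, b) \<in> conn F"
  unfolding conn_def by auto

lemma conn_empty: "(a, b) \<in> conn {} \<longleftrightarrow> a = b"
  by (auto simp: conn_def)

lemma conn_induct [consumes 1, case_names base step]:
  assumes "(a, b) \<in> conn F" "P a"
    and "\<And>y z. (a, y) \<in> conn F \<Longrightarrow> {y, z} \<in> F \<Longrightarrow> P y \<Longrightarrow> P z"
  shows "P b"
  using assms(1) unfolding conn_def
  by (induction rule: rtrancl_induct) (use assms in \<open>auto simp: conn_def\<close>)

text \<open>Follow the walk up to the first edge that leaves \<open>S\<close>. The part before it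
  uses only edges inside \<open>S\<close>, so \<open>{p, q}\<close> is not among them; this
  disjointness later allows the costs of both parts to be added.\<close>

lemma conn_exit:
  assumes "(a, v) \<in> conn F" "a \<in> S" "v \<notin> S"
  obtains p q where "p \<in> S" "q \<notin> S" "{p, q} \<in> F" "(a, p) \<in> conn {e \<in> F. e \<subseteq> S}"
proof -
  let ?ex = "\<exists>p q. p \<in> S \<and> q \<notin> S \<and> {p, q} \<in> F \<and> (a, p) \<in> conn {e \<in> F. e \<subseteq> S}"
  from assms(1) have "?ex \<or> (v \<in> S \<and> (a, v) \<in> conn {e \<in> F. e \<subseteq> S})"
  proof (induction rule: conn_induct)
    case base
    then show ?case using assms by simp
  next
    case (step y z)
    show ?case
    proof (cases ?ex)
      case False
      then have y: "y \<in> S" "(a, y) \<in> conn {e \<in> F. e \<subseteq> S}" using step by auto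
      with False step have "z \<in> S" by blast
      moreover have "(a, z) \<in> conn {e \<in> F. e \<subseteq> S}"
        by (rule conn_trans[OF y(2)], rule conn_edge) (use y step \<open>z \<in> S\<close> in auto)
      ultimately show ?thesis by blast
    qed blast
  qed
  with assms that show ?thesis by blast
qed

lemma sum_Un_le:
  fixes f :: "'a \<Rightarrow> real"
  assumes "finite A" "finite B" "\<And>x. x \<in> A \<union> B \<Longrightarrow> 0 \<le> f x"
  shows "sum f (A \<union> B) \<le> sum f A + sum f B"
proof -
  have "0 \<le> sum f (A \<inter> B)" by (rule sum_nonneg) (use assms in auto)
  with sum.union_inter[of A B f] assms show ?thesis by linarith
qed

section \<open>Path lengths and tours in a pseudometric\<close>

fun plen :: "('a \<Rightarrow> 'a \<Rightarrow> real) \<Rightarrow> 'a list \<Rightarrow> real" where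
  "plen t (x # y # zs) = t x y + plen t (y # zs)"
| "plen t _ = 0"

lemma plen_append: "plen t (xs @ y # zs) = plen t (xs @ [y]) + plen t (y # zs)"
  by (induction t xs rule: plen.induct) auto

locale pseudometric =
  fixes t :: "'a \<Rightarrow> 'a \<Rightarrow> real"
  assumes nonneg: "0 \<le> t x y" and self [simp]: "t x x = 0" and sym: "t x y = t y x"
    and triangle: "t x z \<le> t x y + t y z"
begin

lemma plen_drop: "plen t (x # zs) \<le> plen t (x # y # zs)"
  by (cases zs) (use nonneg triangle[of x _ y] in auto)

lemma plen_tl: "plen t zs \<le> plen t (z # zs)"
  by (cases zs) (auto simp: nonneg)

text \<open>Shortcutting by the triangle inequality: an unwanted or repeated vertex is skipped
  without lengthening the walk. A kept vertex is removed from \<open>S\<close>, so that it is kept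
  only once.\<close>

lemma plen_select:
  "\<exists>zs. set zs = set ys \<inter> S \<and> distinct zs \<and> plen t (x # zs) \<le> plen t (x # ys)"
proof (induction ys arbitrary: x S)
  case Nil
  then show ?case by (intro exI[of _ "[]"]) auto
next
  case (Cons y ys)
  show ?case
  proof (cases "y \<in> S")
    case True
    from Cons[of "S - {y}" y] obtain zs where
      "set zs = set ys \<inter> (S - {y})" "distinct zs" "plen t (y # zs) \<le> plen t (y # ys)" by blast
    then show ?thesis using True by (intro exI[of _ "y # zs"]) auto
  next
    case False
    from Cons[of S x] obtain zs where
      "set zs = set ys \<inter> S" "distinct zs" "plen t (x # zs) \<le> plen t (x # ys)" by blast
    then show ?thesis using False order_trans[OF _ plen_drop]
      by (intro exI[of _ "zs"]) auto
  qed
qed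

text \<open>A walk that uses every edge at most twice, by induction on the edge set. One edge
  \<open>{r, v}\<close> is removed, the edges \<open>F2\<close> in the component of \<open>v\<close>
  are toured from \<open>v\<close>, the others \<open>F1\<close> from \<open>r\<close>. Cycles are
  allowed: if \<open>v\<close> still reaches \<open>r\<close>, then \<open>F2\<close> covers the
  whole component.\<close>

lemma closed_tour:
  fixes w :: "'a set \<Rightarrow> real"
  assumes "finite F" "\<And>e. e \<in> F \<Longrightarrow> 0 \<le> w e" "\<And>u v. {u, v} \<in> F \<Longrightarrow> t u v \<le> w {u, v}"
  shows "\<exists>xs. conn F `` {r} \<subseteq> set (r # xs) \<and> plen t (r # xs @ [r]) \<le> 2 * sum w F"
  using assms
proof (induction F arbitrary: r rule: finite_psubset_induct)
  case (psubset F)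
  show ?case
  proof (cases "\<exists>v. v \<noteq> r \<and> {r, v} \<in> F")
    case False
    have "u = r" if "(r, u) \<in> conn F" for u
      using that by (induction rule: conn_induct) (use False in auto)
    moreover have "0 \<le> sum w F" by (rule sum_nonneg) (use psubset in auto)
    ultimately show ?thesis by (intro exI[of _ "[]"]) auto
  next
    case True
    then obtain v where v: "v \<noteq> r" "{r, v} \<in> F" by blast
    define F' where "F' = F - {{r, v}}"
    define F2 where "F2 = {e \<in> F'. e \<inter> conn F' `` {v} \<noteq> {}}"
    define F1 where "F1 = F' - F2"
    have sub: "F1 \<subset> F" "F2 \<subset> F" using v unfolding F1_def F2_def F'_def by auto
    from psubset.IH[OF sub(1), of r] sub psubset.prems obtain xs1 where
      xs1: "conn F1 `` {r} \<subseteq> set (r # xs1)" "plen t (r # xs1 @ [r]) \<le> 2 * sum w F1" by blast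
    from psubset.IH[OF sub(2), of v] sub psubset.prems obtain xs2 where
      xs2: "conn F2 `` {v} \<subseteq> set (v # xs2)" "plen t (v # xs2 @ [v]) \<le> 2 * sum w F2" by blast
    have F2: "(v, u) \<in> conn F2" if "(v, u) \<in> conn F'" for u
      using that
    proof (induction rule: conn_induct)
      case (step y z)
      then have "{y, z} \<in> F2" unfolding F2_def by auto
      then show ?case using step.IH conn_trans conn_edge by metis
    qed simp
    \<comment> \<open>An edge of \<open>F2\<close> has one and hence both endpoints in the component
      of \<open>v\<close>, while an edge of \<open>F1\<close> continues whichever alternative
      holds.\<close>
    have cover: "(v, u) \<in> conn F' \<or> (r, u) \<in> conn F1" if "(r, u) \<in> conn F" for u
      using that
    proof (induction rule: conn_induct)
      case (step y z)
      show ?case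
      proof (cases "{y, z} \<in> F1")
        case True
        show ?thesis
        proof (cases "(v, y) \<in> conn F'")
          case True
          have "{y, z} \<in> F'" using \<open>{y, z} \<in> F1\<close> F1_def by auto
          then show ?thesis using True conn_trans conn_edge by metis
        next
          case False
          then show ?thesis using step.IH True conn_trans conn_edge by metis
        qed
      next
        case False
        show ?thesis
        proof (cases "{y, z} = {r, v}")
          case True
          then show ?thesis by (auto simp: doubleton_eq_iff)
        next
          case neq: False
          then have e: "{y, z} \<in> F'" "{y, z} \<in> F2" using step False by (auto simp: F'_def F1_def)
          then consider "(v, y) \<in> conn F'" | "(v, z) \<in> conn F'" unfolding F2_def by blast
          then show ?thesis using e conn_trans conn_edge by metis
        qed
      qed
    qed simp
    \<comment> \<open>From \<open>r\<close> to \<open>v\<close>, around \<open>F2\<close>, back to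
      \<open>r\<close>, then around \<open>F1\<close>; the removed edge is traversed twice.\<close>
    let ?xs = "(v # xs2 @ [v]) @ r # xs1"
    have "plen t (r # ?xs @ [r]) = plen t (r # (v # xs2 @ [v]) @ [r]) + plen t (r # xs1 @ [r])"
      using plen_append[of t "r # v # xs2 @ [v]" r "xs1 @ [r]"] by simp
    also have "plen t (r # (v # xs2 @ [v]) @ [r]) = t r v + plen t (v # xs2 @ [v]) + t v r"
      using plen_append[of t "v # xs2" v "[r]"] by simp
    finally have "plen t (r # ?xs @ [r]) \<le> 2 * (w {r, v} + sum w F2 + sum w F1)"
      using xs1 xs2 psubset.prems(2)[OF v(2)] sym[of v r] by simp
    moreover have "sum w F = w {r, v} + (sum w F2 + sum w F1)"
    proof -
      have "finite F'" "{r, v} \<notin> F'" "F = insert {r, v} F'" "F2 \<subseteq> F'"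
        using psubset.hyps v by (auto simp: F'_def F2_def)
      moreover from this have "sum w F' = sum w F1 + sum w F2"
        unfolding F1_def by (simp add: sum.subset_diff)
      ultimately show ?thesis by simp
    qed
    moreover have "conn F `` {r} \<subseteq> set (r # ?xs)"
      using cover F2 xs1(1) xs2(1) by fastforce
    ultimately show ?thesis by (intro exI[of _ ?xs]) auto
  qed
qed

lemma spanning_path:
  fixes w :: "'a set \<Rightarrow> real"
  assumes "finite F" "\<And>e. e \<in> F \<Longrightarrow> 0 \<le> w e" "\<And>u v. {u, v} \<in> F \<Longrightarrow> t u v \<le> w {u, v}"
    and "\<And>u v. u \<in> S \<Longrightarrow> v \<in> S \<Longrightarrow> (u, v) \<in> conn F"
  obtains zs where "set zs = S" "distinct zs" "plen t zs \<le> 2 * sum w F"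
proof (cases "S = {}")
  case True
  then show ?thesis using that[of "[]"] assms sum_nonneg[of F w] by simp
next
  case False
  then obtain r where r: "r \<in> S" by blast
  from closed_tour[of F w r] assms obtain xs where
    xs: "conn F `` {r} \<subseteq> set (r # xs)" "plen t (r # xs @ [r]) \<le> 2 * sum w F" by blast
  have S: "S \<subseteq> set (r # xs)" using xs assms(4) r by blast
  \<comment> \<open>\<open>plen_select\<close> needs a fixed start vertex: a second copy of
    \<open>r\<close> at distance 0, which is dropped again by \<open>plen_tl\<close>.\<close>
  obtain zs where "set zs = set (r # xs @ [r]) \<inter> S" "distinct zs"
    "plen t (r # zs) \<le> plen t (r # r # xs @ [r])"
    using plen_select[of "r # xs @ [r]" S r] by auto
  moreover from this have "plen t zs \<le> 2 * sum w F" using xs plen_tl[of zs r] by simp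
  moreover have "set zs = S" using calculation(1) S by auto
  ultimately show ?thesis using that[of zs] by blast
qed

lemma plen_ge_card:
  assumes "\<And>u v. u \<in> set zs \<Longrightarrow> v \<in> set zs \<Longrightarrow> u \<noteq> v \<Longrightarrow> \<theta> \<le> t u v" "distinct zs"
  shows "(real (length zs) - 1) * \<theta> \<le> plen t zs \<or> zs = []"
  using assms
proof (induction zs rule: induct_list012)
  case (3 x y zs)
  have "\<theta> \<le> t x y" using 3 by auto
  moreover have "(real (length (y # zs)) - 1) * \<theta> \<le> plen t (y # zs)"
    using 3 by (metis distinct.simps(2) list.distinct(1) list.set_intros(2))
  ultimately show ?case by (simp add: algebra_simps)
qed auto

end


section \<open>Spanning trees of a partition\<close>

lemma plen_eq_sum:
  "plen t zs = (\<Sum>(u, v)\<leftarrow>zip zs (tl zs). t u v)"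
  by (induction t zs rule: plen.induct) auto

text \<open>Adjacency after contracting the classes of \<open>cls\<close>: members of one class are
  joined for free. The pairs in \<open>A\<close> are used in both directions.\<close>

definition links :: "'a set \<Rightarrow> ('a \<Rightarrow> 'b) \<Rightarrow> 'a rel \<Rightarrow> 'a rel" where
  "links P cls A = {(u, v). u \<in> P \<and> v \<in> P \<and> (cls u = cls v \<or> (u, v) \<in> A \<or> (v, u) \<in> A)}"

definition joins :: "'a set \<Rightarrow> ('a \<Rightarrow> 'b) \<Rightarrow> 'a rel \<Rightarrow> bool" where
  "joins P cls A \<longleftrightarrow> (\<forall>u\<in>P. \<forall>v\<in>P. (u, v) \<in> (links P cls A)\<^sup>*)"

text \<open>The weight of a minimum spanning tree of the contracted classes. The minimum is over all
  joining edge sets instead of trees, so that exchange arguments only add and delete pairs.\<close>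

definition span_cost :: "('a \<Rightarrow> 'a \<Rightarrow> real) \<Rightarrow> 'a set \<Rightarrow> ('a \<Rightarrow> 'b) \<Rightarrow> real" where
  "span_cost t P cls = Min {\<Sum>(u, v)\<in>A. t u v | A. A \<subseteq> P \<times> P \<and> joins P cls A}"

text \<open>The distance from class \<open>c\<close> to the nearest other class, capped by
  \<open>\<delta>\<close>. The cap is also the value if \<open>c\<close> is the only class.\<close>

definition gap :: "('a \<Rightarrow> 'a \<Rightarrow> real) \<Rightarrow> real \<Rightarrow> 'a set \<Rightarrow> ('a \<Rightarrow> 'b) \<Rightarrow> 'b \<Rightarrow> real" where
  "gap t \<delta> P cls c = Min (insert \<delta> {t u v | u v. u \<in> P \<and> v \<in> P \<and> cls u = c \<and> cls v \<noteq> c})"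

lemma finite_span_set:
  assumes "finite P"
  shows "finite {\<Sum>(u, v)\<in>A. t u v | A. A \<subseteq> P \<times> P \<and> joins P cls A}"
proof -
  have "finite (Pow (P \<times> P))" using assms by simp
  then show ?thesis by (rule finite_surj[where f = "\<lambda>A. \<Sum>(u, v)\<in>A. t u v"]) auto
qed

lemma span_cost_le:
  "finite P \<Longrightarrow> A \<subseteq> P \<times> P \<Longrightarrow> joins P cls A \<Longrightarrow> span_cost t P cls \<le> (\<Sum>(u, v)\<in>A. t u v)"
  unfolding span_cost_def by (rule Min_le[OF finite_span_set]) auto

lemma span_cost_witness:
  assumes "finite P"
  obtains A where "A \<subseteq> P \<times> P" "joins P cls A" "span_cost t P cls = (\<Sum>(u, v)\<in>A. t u v)"
proof -
  have "joins P cls (P \<times> P)" unfolding joins_def links_def by auto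
  then have "span_cost t P cls \<in> {\<Sum>(u, v)\<in>A. t u v | A. A \<subseteq> P \<times> P \<and> joins P cls A}"
    unfolding span_cost_def by (intro Min_in finite_span_set assms) auto
  with that show ?thesis by blast
qed

lemma finite_gap_set:
  assumes "finite P"
  shows "finite {t u v | u v. u \<in> P \<and> v \<in> P \<and> cls u = c \<and> cls v \<noteq> c}"
proof -
  have "finite (P \<times> P)" using assms by simp
  then show ?thesis by (rule finite_surj[where f = "\<lambda>(u, v). t u v"]) auto
qed

lemma gap_le:
  "finite P \<Longrightarrow> u \<in> P \<Longrightarrow> v \<in> P \<Longrightarrow> cls u = c \<Longrightarrow> cls v \<noteq> c \<Longrightarrow> gap t \<delta> P cls c \<le> t u v"
  unfolding gap_def by (rule Min_le) (auto simp: finite_gap_set)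

lemma gap_le_cap: "finite P \<Longrightarrow> gap t \<delta> P cls c \<le> \<delta>"
  unfolding gap_def by (rule Min_le) (auto simp: finite_gap_set)

lemma le_gap:
  assumes "finite P" "m \<le> \<delta>"
    and "\<And>u v. u \<in> P \<Longrightarrow> v \<in> P \<Longrightarrow> cls u = c \<Longrightarrow> cls v \<noteq> c \<Longrightarrow> m \<le> t u v"
  shows "m \<le> gap t \<delta> P cls c"
  unfolding gap_def using assms by (subst Min_ge_iff) (auto simp: finite_gap_set)

text \<open>
  The exchange step for minimum spanning trees: a path from class \<open>c\<close> to the class of \<open>v0\<close> leaves
  \<open>c\<close> for the last time through an edge that can be dropped once both classes are identified.
\<close>

lemma span_cost_merge:
  assumes P: "finite P" "u0 \<in> P" "v0 \<in> P" "cls u0 = c" "cls v0 = c'" "c' \<noteq> c"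
    and t: "\<And>u v. 0 \<le> t u v" "\<And>u v. t u v = t v u"
    and m: "\<And>u v. u \<in> P \<Longrightarrow> v \<in> P \<Longrightarrow> cls u = c \<Longrightarrow> cls v \<noteq> c \<Longrightarrow> m \<le> t u v"
    and cls': "\<And>v. v \<in> P \<Longrightarrow> cls' v = (if cls v = c' then c else cls v)"
  shows "span_cost t P cls' + m \<le> span_cost t P cls"
proof -
  obtain A where A: "A \<subseteq> P \<times> P" "joins P cls A" "span_cost t P cls = (\<Sum>(u, v)\<in>A. t u v)"
    using span_cost_witness[OF P(1)] by blast
  define Out where "Out = {(u, v) \<in> links P cls A. cls u \<noteq> c \<and> cls v \<noteq> c}"
  let ?ex = "\<exists>a b. ((a, b) \<in> A \<or> (b, a) \<in> A) \<and> cls a = c \<and> cls b \<noteq> c \<and> (b, v0) \<in> Out\<^sup>*"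
  have "(u0, v0) \<in> (links P cls A)\<^sup>*" using A P unfolding joins_def by blast
  then have "?ex \<or> (cls u0 \<noteq> c \<and> (u0, v0) \<in> Out\<^sup>*)"
  proof (induction rule: converse_rtrancl_induct)
    case base
    then show ?case using P by auto
  next
    case (step y z)
    show ?case
    proof (cases ?ex)
      case False
      then have z: "cls z \<noteq> c" "(z, v0) \<in> Out\<^sup>*" using step by auto
      have "cls y \<noteq> c"
      proof
        assume "cls y = c"
        then have "(y, z) \<in> A \<or> (z, y) \<in> A" using step(1) z unfolding links_def by auto
        with z False \<open>cls y = c\<close> show False by blast
      qed
      then have "(y, z) \<in> Out" using step(1) z unfolding Out_def by auto
      with z \<open>cls y \<noteq> c\<close> show ?thesis by (meson converse_rtrancl_into_rtrancl)
    qed blast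
  qed
  with P obtain a b where ab: "(a, b) \<in> A \<or> (b, a) \<in> A" "cls a = c" "cls b \<noteq> c" "(b, v0) \<in> Out\<^sup>*"
    by blast
  have abP: "a \<in> P" "b \<in> P" using ab A by auto
  \<comment> \<open>Both orientations are deleted, since \<open>A\<close> may contain either or
    both.\<close>
  define A' where "A' = A - {(a, b), (b, a)}"
  let ?L = "links P cls' A'"
  have symL: "sym ?L" unfolding links_def sym_def by auto
  have eq: "cls' p = cls' q" if "p \<in> P" "q \<in> P" "cls p = cls q" for p q
    by (simp only: cls' that)
  have "Out \<subseteq> ?L" using ab eq unfolding Out_def links_def A'_def by auto
  then have "(b, v0) \<in> ?L\<^sup>*" using ab(4) rtrancl_mono by blast
  \<comment> \<open>After merging, \<open>v0\<close> and \<open>a\<close> lie in one class, so the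
    deleted edge is bypassed through \<open>v0\<close>.\<close>
  moreover have "(v0, a) \<in> ?L" using P ab(2) abP cls' unfolding links_def by auto
  ultimately have ba: "(b, a) \<in> ?L\<^sup>*" by (rule rtrancl_into_rtrancl)
  have ab': "(a, b) \<in> ?L\<^sup>*" using ba symL by (meson sym_rtrancl symD)
  have "links P cls A \<subseteq> ?L\<^sup>*"
  proof (rule subrelI)
    fix p q assume pq: "(p, q) \<in> links P cls A"
    show "(p, q) \<in> ?L\<^sup>*"
    proof (cases "(p, q) = (a, b) \<or> (p, q) = (b, a)")
      case True
      then show ?thesis using ba ab' by auto
    next
      case False
      then have "(p, q) \<in> ?L" using pq eq unfolding links_def A'_def by auto
      then show ?thesis by blast
    qed
  qed
  then have "(links P cls A)\<^sup>* \<subseteq> ?L\<^sup>*" by (rule rtrancl_subset_rtrancl)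
  then have "joins P cls' A'" using A(2) unfolding joins_def by blast
  moreover have "A' \<subseteq> P \<times> P" using A unfolding A'_def by auto
  ultimately have "span_cost t P cls' \<le> (\<Sum>(u, v)\<in>A'. t u v)" using span_cost_le P by blast
  moreover have "(\<Sum>(u, v)\<in>A'. t u v) + m \<le> (\<Sum>(u, v)\<in>A. t u v)"
  proof -
    obtain e where e: "e \<in> A" "e = (a, b) \<or> e = (b, a)" using ab(1) by blast
    have fin: "finite A" using A(1) P(1) finite_subset by blast
    have "m \<le> t a b" using m abP ab by blast
    then have "m \<le> (case e of (u, v) \<Rightarrow> t u v)" using e t by auto
    moreover have "(\<Sum>(u, v)\<in>A'. t u v) \<le> (\<Sum>(u, v)\<in>A - {e}. t u v)"
      by (rule sum_mono2) (use fin e t in \<open>auto simp: A'_def\<close>)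
    moreover have "(\<Sum>(u, v)\<in>A. t u v) = (case e of (u, v) \<Rightarrow> t u v) + (\<Sum>(u, v)\<in>A - {e}. t u v)"
      using sum.remove[OF fin e(1)] by blast
    ultimately show ?thesis by linarith
  qed
  ultimately show ?thesis using A by linarith
qed

text \<open>If there are several classes, each is left by some edge of an optimal joining set, and
  that edge is at least as long as the gap. An edge is charged only by the classes of its two
  endpoints. The extra \<open>\<delta>\<close> covers a single class, whose gap is bounded by the
  cap alone.\<close>

lemma sum_gap_le:
  fixes cls :: "'a \<Rightarrow> 'b"
  assumes P: "finite P" and M: "M \<subseteq> cls ` P" and \<delta>: "0 \<le> \<delta>"
    and t: "\<And>u v. 0 \<le> t u v" "\<And>u v. t u v = t v u"
  shows "(\<Sum>c\<in>M. gap t \<delta> P cls c) \<le> 2 * span_cost t P cls + \<delta>"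
proof -
  obtain A where A: "A \<subseteq> P \<times> P" "joins P cls A" "span_cost t P cls = (\<Sum>(u, v)\<in>A. t u v)"
    using span_cost_witness[OF P(1)] by blast
  have fin: "finite A" "finite M" "finite (cls ` P)" using A(1) P M finite_subset by blast+
  have span: "0 \<le> span_cost t P cls" using A t by (auto intro!: sum_nonneg)
  show ?thesis
  proof (cases "\<exists>d\<in>cls ` P. cls ` P = {d}")
    case True
    then obtain d where d: "M \<subseteq> {d}" using M by blast
    then consider "M = {}" | "M = {d}" by blast
    then show ?thesis
      by cases (use \<delta> span gap_le_cap[OF P, of t \<delta> cls d] in auto)
  next
    case False
    \<comment> \<open>The length of \<open>e\<close> as far as it is charged to class
      \<open>c\<close>: all of it if \<open>e\<close> touches \<open>c\<close>.\<close>
    define f where "f c e = (case e of (u, v) \<Rightarrow> if cls u = c \<or> cls v = c then t u v else 0)" for c e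
    have gap: "gap t \<delta> P cls c \<le> (\<Sum>e\<in>A. f c e)" if "c \<in> M" for c
    proof -
      from that M obtain u where u: "u \<in> P" "cls u = c" by blast
      with False obtain v where v: "v \<in> P" "cls v \<noteq> c" by blast
      have "(u, v) \<in> (links P cls A)\<^sup>*" using u v A unfolding joins_def by blast
      then have "\<exists>p q. (p, q) \<in> links P cls A \<and> cls p = c \<and> cls q \<noteq> c"
        using u(2) v(2) by (induction rule: converse_rtrancl_induct) auto
      then obtain p q where pq: "(p, q) \<in> A \<or> (q, p) \<in> A" "p \<in> P" "q \<in> P" "cls p = c" "cls q \<noteq> c"
        unfolding links_def by auto
      then obtain e where e: "e \<in> A" "e = (p, q) \<or> e = (q, p)" by blast
      have "gap t \<delta> P cls c \<le> t p q" by (rule gap_le) (use pq P in auto)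
      also have "\<dots> = f c e" using e pq t unfolding f_def by auto
      also have "\<dots> \<le> (\<Sum>e\<in>A. f c e)"
        by (rule member_le_sum[OF e(1)]) (use t fin in \<open>auto simp: f_def\<close>)
      finally show ?thesis .
    qed
    have "(\<Sum>c\<in>M. gap t \<delta> P cls c) \<le> (\<Sum>c\<in>M. \<Sum>e\<in>A. f c e)" by (rule sum_mono[OF gap])
    also have "\<dots> = (\<Sum>e\<in>A. \<Sum>c\<in>M. f c e)" by (rule sum.swap)
    also have "\<dots> \<le> (\<Sum>e\<in>A. 2 * (case e of (u, v) \<Rightarrow> t u v))"
    proof (rule sum_mono)
      fix e assume "e \<in> A"
      obtain u v where e: "e = (u, v)" by force
      have "(\<Sum>c\<in>M. f c e) \<le> (\<Sum>c\<in>M. (if cls u = c then t u v else 0) + (if cls v = c then t u v else 0))"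
        by (rule sum_mono) (use t in \<open>auto simp: f_def e\<close>)
      also have "\<dots> \<le> 2 * t u v" using fin t by (simp add: sum.distrib)
      finally show "(\<Sum>c\<in>M. f c e) \<le> 2 * (case e of (u, v) \<Rightarrow> t u v)" by (simp add: e)
    qed
    also have "\<dots> = 2 * span_cost t P cls" using A by (simp add: sum_distrib_left)
    finally show ?thesis using \<delta> by linarith
  qed
qed

text \<open>By the counting hypothesis the smallest of \<open>m + 2\<close> values is at most
  \<open>2 * W / (m + 1)\<close>. Removing the smallest value again and again gives a harmonic sum,
  estimated by increments of the logarithm. Two values remain at the end, each at most
  \<open>W\<close>.\<close>

lemma harmonic_bound:
  assumes "finite Y" "card Y \<le> m + 1" "1 \<le> m" "0 \<le> W"
    and "\<And>y. y \<in> Y \<Longrightarrow> 0 \<le> g y" "\<And>y. y \<in> Y \<Longrightarrow> g y \<le> W"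
    and "\<And>\<theta>. 0 \<le> \<theta> \<Longrightarrow> (real (card {y \<in> Y. \<theta> \<le> g y}) - 1) * \<theta> \<le> 2 * W"
  shows "sum g Y \<le> W * (3 + 2 * ln (real m))"
  using assms(3,1,2,5,6,7)
proof (induction m arbitrary: Y rule: nat_induct_at_least)
  case base
  have "sum g Y \<le> real (card Y) * W" by (rule sum_bounded_above) (use base in auto)
  also have "\<dots> \<le> 2 * W" using base assms(4) by (intro mult_right_mono) auto
  finally show ?case using assms(4) by simp
next
  case (Suc m)
  have mono: "W * (3 + 2 * ln (real m)) \<le> W * (3 + 2 * ln (real (Suc m)))"
    using Suc.hyps assms(4) by (intro mult_left_mono) auto
  show ?case
  proof (cases "card Y \<le> m + 1")
    case True
    then show ?thesis using Suc.IH[of Y] Suc.prems mono by force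
  next
    case False
    then have cY: "card Y = m + 2" "Y \<noteq> {}" using Suc.prems by auto
    obtain y where y: "y \<in> Y" "\<And>z. z \<in> Y \<Longrightarrow> g y \<le> g z"
      using ex_is_arg_min_if_finite[of Y g] Suc.prems(1) cY unfolding is_arg_min_linorder by blast
    have "{z \<in> Y. g y \<le> g z} = Y" using y by auto
    then have "(real m + 1) * g y \<le> 2 * W" 
      using Suc.prems(5)[of "g y"] Suc.prems(3)[OF y(1)] cY by (simp add: add.commute)
    then have gy: "g y \<le> 2 * W / (real m + 1)" by (simp add: field_simps)
    have IH: "sum g (Y - {y}) \<le> W * (3 + 2 * ln (real m))"
    proof (rule Suc.IH)
      fix \<theta> :: real assume "0 \<le> \<theta>"
      have "card {z \<in> Y - {y}. \<theta> \<le> g z} \<le> card {z \<in> Y. \<theta> \<le> g z}"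
        by (rule card_mono) (use Suc.prems in auto)
      then have "(real (card {z \<in> Y - {y}. \<theta> \<le> g z}) - 1) * \<theta> \<le> (real (card {z \<in> Y. \<theta> \<le> g z}) - 1) * \<theta>"
        using \<open>0 \<le> \<theta>\<close> by (intro mult_right_mono) auto
      then show "(real (card {z \<in> Y - {y}. \<theta> \<le> g z}) - 1) * \<theta> \<le> 2 * W"
        using Suc.prems(5)[OF \<open>0 \<le> \<theta>\<close>] by linarith
    qed (use Suc.prems y cY in auto)
    \<comment> \<open>The inequality \<open>ln z \<le> z - 1\<close> at
      \<open>z = m / (m + 1)\<close> bounds a harmonic term by a difference of logarithms.\<close>
    have "ln (real m / (real m + 1)) \<le> real m / (real m + 1) - 1"
      using Suc.hyps by (intro ln_le_minus_one) auto
    then have "1 / (real m + 1) \<le> ln (real m + 1) - ln (real m)"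
      using Suc.hyps by (simp add: ln_div field_simps)
    then have "2 * W * (1 / (real m + 1)) \<le> 2 * W * (ln (real m + 1) - ln (real m))"
      using assms(4) by (intro mult_left_mono) auto
    with gy have "g y \<le> 2 * W * (ln (real m + 1) - ln (real m))" by simp
    moreover have "sum g Y = g y + sum g (Y - {y})" using y Suc.prems sum.remove by metis
    ultimately show ?thesis using IH by (simp add: algebra_simps)
  qed
qed

section \<open>The analysis of the costs\<close>

lemma span_cost_cong:
  assumes "\<And>v. v \<in> P \<Longrightarrow> cls v = cls' v"
  shows "span_cost t P cls = span_cost t P cls'"
proof -
  have "links P cls = links P cls'" unfolding links_def using assms by (intro ext) auto
  then show ?thesis unfolding span_cost_def joins_def by simp
qed

text \<open>The constant is 7 for the truncated costs plus 3 from \<open>harmonic_bound\<close>,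
  whose logarithm is taken at \<open>m = 2 * \<eta> + 2\<close>.\<close>

definition ratio :: "nat \<Rightarrow> real" where
  "ratio \<eta> = 10 + 2 * ln (2 * real \<eta> + 2)"

section \<open>Truncated distances in a weighted graph\<close>

locale steiner_graph =
  fixes n :: nat and E :: "nat set set" and w :: "nat set \<Rightarrow> real"
  assumes graph: "weighted_graph n E w"
begin

lemma finite_E: "finite E"
proof (rule finite_subset)
  show "E \<subseteq> Pow {..<n}" using graph unfolding weighted_graph_def by auto
qed simp

lemma edgeD: "{u, v} \<in> E \<Longrightarrow> u < n \<and> v < n \<and> u \<noteq> v"
  using graph unfolding weighted_graph_def by fastforce

lemma w_nonneg: "e \<in> E \<Longrightarrow> 0 \<le> w e"
  using graph unfolding weighted_graph_def by auto

lemma w_mono: "F \<subseteq> F' \<Longrightarrow> F' \<subseteq> E \<Longrightarrow> sum w F \<le> sum w F'"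
  using finite_E w_nonneg by (intro sum_mono2) (auto intro: finite_subset)

lemma w_sum_nonneg: "F \<subseteq> E \<Longrightarrow> 0 \<le> sum w F"
  using w_nonneg by (intro sum_nonneg) auto

lemma w_Un: "F \<subseteq> E \<Longrightarrow> F' \<subseteq> E \<Longrightarrow> sum w (F \<union> F') \<le> sum w F + sum w F'"
  using finite_E w_nonneg by (intro sum_Un_le) (auto intro: finite_subset)

text \<open>The shortest path distance capped by \<open>\<delta>\<close>; the cap also serves
  vertices in different components. Minimizing over connecting edge sets instead of paths makes
  unions directly available as upper bounds.\<close>

definition td :: "real \<Rightarrow> nat \<Rightarrow> nat \<Rightarrow> real" where
  "td \<delta> u v = Min (insert \<delta> {sum w F | F. F \<subseteq> E \<and> (u, v) \<in> conn F})"

lemma finite_td: "finite {sum w F | F. F \<subseteq> E \<and> (u, v) \<in> conn F}"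
proof (rule finite_surj)
  show "finite (Pow E)" using finite_E by simp
  show "{sum w F | F. F \<subseteq> E \<and> (u, v) \<in> conn F} \<subseteq> sum w ` Pow E" by auto
qed

lemma td_le_cap: "td \<delta> u v \<le> \<delta>"
  unfolding td_def by (rule Min_le) (auto simp: finite_td)

lemma td_le: "F \<subseteq> E \<Longrightarrow> (u, v) \<in> conn F \<Longrightarrow> td \<delta> u v \<le> sum w F"
  unfolding td_def by (rule Min_le) (auto simp: finite_td)

lemma le_td:
  "m \<le> \<delta> \<Longrightarrow> (\<And>F. F \<subseteq> E \<Longrightarrow> (u, v) \<in> conn F \<Longrightarrow> m \<le> sum w F) \<Longrightarrow> m \<le> td \<delta> u v"
  unfolding td_def by (subst Min_ge_iff) (auto simp: finite_td)

lemma td_cases: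
  obtains "td \<delta> u v = \<delta>" | F where "F \<subseteq> E" "(u, v) \<in> conn F" "td \<delta> u v = sum w F"
proof -
  have "td \<delta> u v \<in> insert \<delta> {sum w F | F. F \<subseteq> E \<and> (u, v) \<in> conn F}"
    unfolding td_def by (rule Min_in) (auto simp: finite_td)
  with that show ?thesis by auto
qed

lemma td_nonneg: "0 \<le> \<delta> \<Longrightarrow> 0 \<le> td \<delta> u v"
  by (rule le_td) (auto intro: w_sum_nonneg)

lemma td_sym: "td \<delta> u v = td \<delta> v u"
proof -
  have "(u, v) \<in> conn F \<longleftrightarrow> (v, u) \<in> conn F" for F by (blast intro: conn_sym)
  then show ?thesis unfolding td_def by simp
qed

text \<open>For the triangle inequality, two connecting edge sets are united; if one of the
  distances equals the cap, nothing is left to show.\<close>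

lemma pseudometric_td: "0 \<le> \<delta> \<Longrightarrow> pseudometric (td \<delta>)"
proof
  fix x y z assume \<delta>: "0 \<le> \<delta>"
  show "0 \<le> td \<delta> x y" using td_nonneg \<delta> .
  show "td \<delta> x x = 0" using td_le[of "{}" x x \<delta>] td_nonneg[OF \<delta>, of x x] by simp
  show "td \<delta> x y = td \<delta> y x" by (rule td_sym)
  show "td \<delta> x z \<le> td \<delta> x y + td \<delta> y z"
  proof (cases rule: td_cases[of \<delta> x y])
    case 1
    then show ?thesis using td_le_cap[of \<delta> x z] td_nonneg[OF \<delta>, of y z] by linarith
  next
    case F: (2 F)
    show ?thesis
    proof (cases rule: td_cases[of \<delta> y z])
      case 1
      then show ?thesis using td_le_cap[of \<delta> x z] td_nonneg[OF \<delta>, of x y] by linarith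
    next
      case F': (2 F')
      have "(x, z) \<in> conn (F \<union> F')"
        using F(2) F'(2) by (meson conn_mono conn_trans sup_ge1 sup_ge2)
      then have "td \<delta> x z \<le> sum w (F \<union> F')" using F F' by (intro td_le) auto
      also have "\<dots> \<le> sum w F + sum w F'" using F F' by (intro w_Un)
      finally show ?thesis using F F' by linarith
    qed
  qed
qed

text \<open>The potential of the amortized analysis: truncated greedy costs and twice the remaining
  spanning tree are paid by twice the initial spanning tree and by the gaps of classes with arrived
  predicted terminals. All \<open>\<delta>\<close> are treated at once, because the right threshold
  depends on the optimum and the error, which the algorithm does not know.\<close>

definition balanced :: "nat set \<Rightarrow> (nat \<Rightarrow> nat) \<Rightarrow> nat set \<Rightarrow> (nat \<Rightarrow> real) \<Rightarrow> bool" where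
  "balanced P cls A g \<longleftrightarrow> (\<forall>\<delta>\<ge>0.
     (\<Sum>y\<in>A \<inter> P. min (g y) \<delta>) + 2 * span_cost (td \<delta>) P cls
       \<le> 2 * span_cost (td \<delta>) P id + (\<Sum>c\<in>cls ` (A \<inter> P). gap (td \<delta>) \<delta> P cls c))"

text \<open>
  The invariant while the class of a new terminal \<open>x\<close> grows, where \<open>\<gamma>\<close> is the greedy cost of \<open>x\<close>
  and \<open>\<beta>\<close> the part of it that is not yet spent. The class of \<open>x\<close> does not contribute its gap
  before it has stopped growing, except when \<open>\<gamma> = 0\<close>: then it does not grow at all.
\<close>

definition growing ::
    "nat set \<Rightarrow> (nat \<Rightarrow> nat) \<Rightarrow> nat set \<Rightarrow> (nat \<Rightarrow> real) \<Rightarrow> nat \<Rightarrow> real \<Rightarrow> real \<Rightarrow> bool" where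
  "growing P cls A g x \<gamma> \<beta> \<longleftrightarrow> 0 \<le> \<beta> \<and> \<beta> \<le> \<gamma> \<and> (\<forall>\<delta>\<ge>0.
     (\<Sum>y\<in>A \<inter> P. min (g y) \<delta>) + 2 * span_cost (td \<delta>) P cls + min (\<gamma> - \<beta>) \<delta>
       \<le> 2 * span_cost (td \<delta>) P id +
          (\<Sum>c\<in>(if \<gamma> = 0 then cls ` (A \<inter> P) else cls ` (A \<inter> P) - {cls x}). gap (td \<delta>) \<delta> P cls c))"

text \<open>The stopping condition of growth: no predicted vertex of another class is closer to
  class \<open>c\<close> than the remaining budget \<open>\<beta>\<close>.\<close>

definition saturated :: "nat set \<Rightarrow> (nat \<Rightarrow> nat) \<Rightarrow> nat \<Rightarrow> real \<Rightarrow> bool" where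
  "saturated P cls c \<beta> \<longleftrightarrow> (\<forall>u\<in>P. \<forall>v\<in>P. \<forall>F\<subseteq>E.
     cls u = c \<longrightarrow> cls v \<noteq> c \<longrightarrow> (u, v) \<in> conn F \<longrightarrow> \<beta> \<le> sum w F)"

lemma saturatedD:
  "saturated P cls c \<beta> \<Longrightarrow> u \<in> P \<Longrightarrow> v \<in> P \<Longrightarrow> cls u = c \<Longrightarrow> cls v \<noteq> c \<Longrightarrow> F \<subseteq> E \<Longrightarrow>
    (u, v) \<in> conn F \<Longrightarrow> \<beta> \<le> sum w F"
  unfolding saturated_def by blast

text \<open>If \<open>\<gamma>\<close> is positive, the class of \<open>x\<close> contains no
  earlier predicted terminal, so leaving out its gap does not change the sum.\<close>

lemma growing_start:
  assumes "balanced P cls A g" "0 \<le> \<gamma>" "0 < \<gamma> \<Longrightarrow> cls x \<notin> cls ` (A \<inter> P)"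
  shows "growing P cls A g x \<gamma> \<gamma>"
proof -
  have "(if \<gamma> = 0 then cls ` (A \<inter> P) else cls ` (A \<inter> P) - {cls x}) = cls ` (A \<inter> P)"
    using assms by auto
  then show ?thesis using assms unfolding growing_def balanced_def by simp
qed

text \<open>Merging lowers \<open>2 * span_cost\<close> by at least
  \<open>2 * min r \<delta>\<close>. One half pays for the increase of the spent budget, the other
  for the gap of the absorbed class, which may drop out of the sum.\<close>

lemma growing_merge:
  assumes P: "finite P" and gr: "growing P cls A g x \<gamma> \<beta>" and r: "0 \<le> r" "r < \<beta>"
    and uv: "u \<in> P" "v \<in> P" "cls u = cls x" "cls v \<noteq> cls x"
    and F: "F \<subseteq> E" "(u, v) \<in> conn F" "sum w F \<le> r"
    and sat: "saturated P cls (cls x) r"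
    and cls': "\<And>p. p \<in> insert x P \<Longrightarrow> cls' p = (if cls p = cls v then cls x else cls p)"
  shows "growing P cls' A g x \<gamma> (\<beta> - r)"
proof -
  have \<gamma>: "0 < \<gamma>" "\<beta> \<le> \<gamma>" using gr r unfolding growing_def by auto
  have x: "cls' x = cls x" using cls' by auto
  have "(\<Sum>y\<in>A \<inter> P. min (g y) \<delta>) + 2 * span_cost (td \<delta>) P cls' + min (\<gamma> - (\<beta> - r)) \<delta>
       \<le> 2 * span_cost (td \<delta>) P id + (\<Sum>c\<in>cls' ` (A \<inter> P) - {cls' x}. gap (td \<delta>) \<delta> P cls' c)"
    if \<delta>: "0 \<le> \<delta>" for \<delta>
  proof -
    let ?m = "min r \<delta>" and ?c = "cls x" and ?c' = "cls v"
    let ?M = "cls ` (A \<inter> P) - {?c}"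
    have m: "?m \<le> td \<delta> p q" if "p \<in> P" "q \<in> P" "cls p = ?c" "cls q \<noteq> ?c" for p q
    proof (rule le_td)
      fix F assume "F \<subseteq> E" "(p, q) \<in> conn F"
      from saturatedD[OF sat that this] show "?m \<le> sum w F" by simp
    qed simp
    have span: "span_cost (td \<delta>) P cls' + ?m \<le> span_cost (td \<delta>) P cls"
      by (rule span_cost_merge[OF P uv(1,2,3) refl uv(4)])
        (use \<delta> m cls' td_sym in \<open>auto intro: td_nonneg\<close>)
    have img: "cls' ` (A \<inter> P) - {?c} = ?M - {?c'}"
    proof -
      have "cls' ` (A \<inter> P) = (\<lambda>p. if cls p = ?c' then ?c else cls p) ` (A \<inter> P)"
        by (rule image_cong) (use cls' in auto)
      then show ?thesis using uv by auto
    qed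
    have gap: "gap (td \<delta>) \<delta> P cls' d = gap (td \<delta>) \<delta> P cls d" if "d \<in> ?M - {?c'}" for d
    proof -
      have "cls' p = d \<longleftrightarrow> cls p = d" if "p \<in> P" for p
        using cls'[of p] that \<open>d \<in> ?M - {?c'}\<close> by auto
      then show ?thesis unfolding gap_def by (metis (no_types, lifting))
    qed
    \<comment> \<open>The absorbed class is within distance \<open>r\<close> of the class of
      \<open>x\<close>, so its gap is at most \<open>min r \<delta>\<close>.\<close>
    have "gap (td \<delta>) \<delta> P cls ?c' \<le> td \<delta> v u" by (rule gap_le) (use P uv in auto)
    also have "td \<delta> v u \<le> ?m" using td_le[OF F(1,2), of \<delta>] td_le_cap[of \<delta> v u] F td_sym[of \<delta> u v] by simp
    finally have gap': "gap (td \<delta>) \<delta> P cls ?c' \<le> ?m" .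
    have "(\<Sum>c\<in>?M. gap (td \<delta>) \<delta> P cls c) - ?m \<le> (\<Sum>c\<in>?M - {?c'}. gap (td \<delta>) \<delta> P cls c)"
      using gap' P r \<delta> by (simp add: sum_diff1)
    also have "\<dots> = (\<Sum>c\<in>cls' ` (A \<inter> P) - {cls' x}. gap (td \<delta>) \<delta> P cls' c)"
      unfolding x img by (rule sum.cong) (use gap in auto)
    finally have "(\<Sum>c\<in>?M. gap (td \<delta>) \<delta> P cls c) - ?m \<le>
      (\<Sum>c\<in>cls' ` (A \<inter> P) - {cls' x}. gap (td \<delta>) \<delta> P cls' c)" .
    moreover have "(\<Sum>y\<in>A \<inter> P. min (g y) \<delta>) + 2 * span_cost (td \<delta>) P cls + min (\<gamma> - \<beta>) \<delta>
       \<le> 2 * span_cost (td \<delta>) P id + (\<Sum>c\<in>?M. gap (td \<delta>) \<delta> P cls c)"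
      using gr \<gamma> \<delta> unfolding growing_def by auto
    moreover have "min (\<gamma> - (\<beta> - r)) \<delta> \<le> min (\<gamma> - \<beta>) \<delta> + ?m" using r \<gamma> \<delta> by linarith
    ultimately show ?thesis using span by linarith
  qed
  then show ?thesis using \<gamma> r unfolding growing_def by auto
qed

text \<open>The unspent budget \<open>\<beta>\<close> is at most the distance to any other class.
  Hence the gap of the class of \<open>x\<close>, which is counted from now on, pays for
  \<open>min \<beta> \<delta>\<close>; the spent part is already accounted for.\<close>

lemma growing_finish:
  assumes P: "finite P" and gr: "growing P cls A g x \<gamma> \<beta>" and x: "x \<in> P" "x \<notin> A"
    and sat: "saturated P cls (cls x) \<beta>"
  shows "balanced P cls (insert x A) (g(x := \<gamma>))"
  unfolding balanced_def
proof (intro allI impI)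
  fix \<delta> :: real assume \<delta>: "0 \<le> \<delta>"
  let ?gap = "gap (td \<delta>) \<delta> P cls"
  have \<beta>: "0 \<le> \<beta>" "\<beta> \<le> \<gamma>" using gr unfolding growing_def by auto
  have Ax: "insert x A \<inter> P = insert x (A \<inter> P)" "x \<notin> A \<inter> P" "finite (A \<inter> P)" using x P by auto
  have "(\<Sum>y\<in>A \<inter> P. min ((g(x := \<gamma>)) y) \<delta>) = (\<Sum>y\<in>A \<inter> P. min (g y) \<delta>)"
    by (rule sum.cong) (use x in auto)
  then have sum: "(\<Sum>y\<in>insert x A \<inter> P. min ((g(x := \<gamma>)) y) \<delta>) = min \<gamma> \<delta> + (\<Sum>y\<in>A \<inter> P. min (g y) \<delta>)"
    using Ax by simp
  have gap: "min \<beta> \<delta> \<le> ?gap (cls x)"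
  proof (rule le_gap[OF P])
    fix u v assume "u \<in> P" "v \<in> P" "cls u = cls x" "cls v \<noteq> cls x"
    note uv = this
    show "min \<beta> \<delta> \<le> td \<delta> u v"
    proof (rule le_td)
      fix F assume "F \<subseteq> E" "(u, v) \<in> conn F"
      from saturatedD[OF sat uv this] show "min \<beta> \<delta> \<le> sum w F" by simp
    qed simp
  qed simp
  have gap_nonneg: "0 \<le> ?gap c" for c by (rule le_gap[OF P]) (use \<delta> in \<open>auto intro: td_nonneg\<close>)
  have "min \<gamma> \<delta> - min (\<gamma> - \<beta>) \<delta> +
     (\<Sum>c\<in>(if \<gamma> = 0 then cls ` (A \<inter> P) else cls ` (A \<inter> P) - {cls x}). ?gap c)
     \<le> (\<Sum>c\<in>cls ` (insert x A \<inter> P). ?gap c)"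
  proof (cases "\<gamma> = 0")
    case True
    have "(\<Sum>c\<in>cls ` (A \<inter> P). ?gap c) \<le> (\<Sum>c\<in>cls ` (insert x A \<inter> P). ?gap c)"
      by (rule sum_mono2) (use P gap_nonneg in auto)
    then show ?thesis using True \<beta> by auto
  next
    case False
    have "(\<Sum>c\<in>cls ` (insert x A \<inter> P). ?gap c) = ?gap (cls x) + (\<Sum>c\<in>cls ` (A \<inter> P) - {cls x}. ?gap c)"
      unfolding Ax image_insert using Ax by (subst sum.insert_remove) auto
    moreover have "min \<gamma> \<delta> \<le> min (\<gamma> - \<beta>) \<delta> + min \<beta> \<delta>" using \<beta> \<delta> by linarith
    ultimately show ?thesis using False gap by simp
  qed
  moreover have "(\<Sum>y\<in>A \<inter> P. min (g y) \<delta>) + 2 * span_cost (td \<delta>) P cls + min (\<gamma> - \<beta>) \<delta>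
       \<le> 2 * span_cost (td \<delta>) P id +
          (\<Sum>c\<in>(if \<gamma> = 0 then cls ` (A \<inter> P) else cls ` (A \<inter> P) - {cls x}). ?gap c)"
    using gr \<delta> unfolding growing_def by blast
  ultimately show "(\<Sum>y\<in>insert x A \<inter> P. min ((g(x := \<gamma>)) y) \<delta>) + 2 * span_cost (td \<delta>) P cls
     \<le> 2 * span_cost (td \<delta>) P id + (\<Sum>c\<in>cls ` (insert x A \<inter> P). ?gap c)"
    using sum by linarith
qed

lemma span_cost_id_le:
  assumes P: "finite P" and \<delta>: "0 \<le> \<delta>" and F: "F \<subseteq> E" "connects F X" and ne: "X \<inter> P \<noteq> {}"
  shows "span_cost (td \<delta>) P (id :: nat \<Rightarrow> nat) \<le> 2 * sum w F + real (card (P - X)) * \<delta>"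
proof -
  interpret pseudometric "td \<delta>" using pseudometric_td[OF \<delta>] .
  obtain zs where zs: "set zs = X \<inter> P" "distinct zs" "plen (td \<delta>) zs \<le> 2 * sum w F"
  proof (rule spanning_path[where F = F and w = w and S = "X \<inter> P"])
    show "finite F" using F finite_E finite_subset by blast
    show "0 \<le> w e" if "e \<in> F" for e using that F w_nonneg by auto
    show "td \<delta> u v \<le> w {u, v}" if "{u, v} \<in> F" for u v
      using td_le[of "{{u, v}}" u v \<delta>] that F by (auto intro: conn_edge)
    show "(u, v) \<in> conn F" if "u \<in> X \<inter> P" "v \<in> X \<inter> P" for u v
      using that F unfolding connects_conn by blast
  qed (use that in blast)
  obtain x0 zs' where x0: "zs = x0 # zs'" using zs(1) ne by (cases zs) auto
  \<comment> \<open>\<open>A1\<close> consists of the steps of the tour, \<open>A2\<close> is the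
    star around its first vertex.\<close>
  define A1 where "A1 = set (zip zs (tl zs))"
  define A2 where "A2 = {x0} \<times> (P - X)"
  have fin: "finite A1" "finite A2" unfolding A1_def A2_def using P by auto
  define I where "I = (id :: nat \<Rightarrow> nat)"
  let ?L = "links P I (A1 \<union> A2)"
  have A12: "A1 \<union> A2 \<subseteq> P \<times> P"
  proof -
    have "set (tl zs) \<subseteq> set zs" using x0 by auto
    then have "A1 \<subseteq> P \<times> P"
      unfolding A1_def using zs(1) by (auto dest: set_zip_leftD set_zip_rightD)
    moreover have "x0 \<in> P" using zs(1) x0 by auto
    ultimately show ?thesis unfolding A2_def by auto
  qed
  have "(x0, y) \<in> ?L\<^sup>*" if "y \<in> P" for y
  proof (cases "y \<in> X")
    case False
    then show ?thesis using that A12 unfolding links_def A2_def by auto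
  next
    case True
    have *: "(hd ys, y) \<in> ?L\<^sup>*" if "y \<in> set ys" "set (zip ys (tl ys)) \<subseteq> ?L" for ys
      using that
    proof (induction ys rule: induct_list012)
      case (3 a b ys)
      show ?case
      proof (cases "y = a")
        case False
        then have "(b, y) \<in> ?L\<^sup>*" using 3 by auto
        moreover have "(a, b) \<in> ?L" using 3 by auto
        ultimately show ?thesis by (simp add: converse_rtrancl_into_rtrancl)
      qed simp
    qed auto
    have "A1 \<subseteq> ?L" using A12 unfolding links_def by auto
    then show ?thesis using *[of zs] x0 zs(1) True that unfolding A1_def by auto
  qed
  moreover have "sym ?L" unfolding links_def sym_def by auto
  ultimately have "joins P I (A1 \<union> A2)"
    unfolding joins_def by (meson rtrancl_trans sym_rtrancl symD)
  then have "span_cost (td \<delta>) P (id :: nat \<Rightarrow> nat) \<le> (\<Sum>(u, v)\<in>A1 \<union> A2. td \<delta> u v)"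
    using span_cost_le P A12 unfolding I_def by blast
  also have "\<dots> \<le> (\<Sum>(u, v)\<in>A1. td \<delta> u v) + (\<Sum>(u, v)\<in>A2. td \<delta> u v)"
    by (rule sum_Un_le) (use fin nonneg in auto)
  also have "(\<Sum>(u, v)\<in>A1. td \<delta> u v) = plen (td \<delta>) zs"
    unfolding A1_def plen_eq_sum
    by (rule sum.distinct_set_conv_list) (simp add: distinct_zipI1 zs)
  also have "(\<Sum>(u, v)\<in>A2. td \<delta> u v) \<le> real (card A2) * \<delta>"
    by (rule sum_bounded_above) (use td_le_cap in auto)
  also have "card A2 = card (P - X)" unfolding A2_def by (simp add: card_cartesian_product)
  finally show ?thesis using zs by linarith
qed

text \<open>A tour of \<open>F\<close> through \<open>Y\<close> makes \<open>card Y - 1\<close>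
  steps of length at least \<open>\<theta>\<close> and costs at most twice \<open>F\<close>. For
  this, distances may be capped at \<open>\<theta>\<close>.\<close>

lemma packing:
  assumes F: "F \<subseteq> E" "connects F Y" and "finite Y" "0 \<le> \<theta>"
    and sep: "\<And>x y. x \<in> Y \<Longrightarrow> y \<in> Y \<Longrightarrow> x \<noteq> y \<Longrightarrow> \<theta> \<le> td \<theta> x y"
  shows "(real (card Y) - 1) * \<theta> \<le> 2 * sum w F"
proof -
  interpret pseudometric "td \<theta>" using pseudometric_td[OF assms(4)] .
  obtain zs where zs: "set zs = Y" "distinct zs" "plen (td \<theta>) zs \<le> 2 * sum w F"
  proof (rule spanning_path[where F = F and w = w and S = Y])
    show "finite F" using F finite_E finite_subset by blast
    show "0 \<le> w e" if "e \<in> F" for e using that F w_nonneg by auto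
    show "td \<theta> u v \<le> w {u, v}" if "{u, v} \<in> F" for u v
      using td_le[of "{{u, v}}" u v \<theta>] that F by (auto intro: conn_edge)
    show "(u, v) \<in> conn F" if "u \<in> Y" "v \<in> Y" for u v
      using that F unfolding connects_conn by blast
  qed (use that in blast)
  have card: "length zs = card Y" using zs distinct_card by metis
  show ?thesis
  proof (cases "zs = []")
    case True
    then show ?thesis using card assms(4) w_sum_nonneg[OF F(1)] by simp
  next
    case False
    then show ?thesis using plen_ge_card[of zs \<theta>] zs sep card by force
  qed
qed

lemma steiner_opt_witness:
  assumes "connects E X"
  obtains F where "F \<subseteq> E" "connects F X" "steiner_opt E w X = sum w F"
proof -
  have "finite {sum w F | F. F \<subseteq> E \<and> connects F X}"
    by (rule finite_surj[where A = "Pow E" and f = "sum w"]) (use finite_E in auto)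
  then have "steiner_opt E w X \<in> {sum w F | F. F \<subseteq> E \<and> connects F X}"
    unfolding steiner_opt_def by (rule Min_in) (use assms in auto)
  with that show ?thesis by blast
qed

text \<open>Costs up to a threshold are bounded through the balance, the few larger ones by a
  harmonic sum. \<open>sep\<close> feeds the packing argument, and \<open>solo\<close> bounds each
  single cost by the optimum. The order of arrival does not occur.\<close>

lemma greedy_cost_bound:
  assumes bal: "balanced P cls X g" and P: "finite P" and X: "finite X" "connects E X"
    and g: "\<And>x. x \<in> X \<Longrightarrow> 0 \<le> g x"
    and sep: "\<And>x y F. x \<in> X \<Longrightarrow> y \<in> X \<Longrightarrow> x \<noteq> y \<Longrightarrow> F \<subseteq> E \<Longrightarrow> (x, y) \<in> conn F \<Longrightarrow>
      min (g x) (g y) \<le> sum w F"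
    and solo: "\<And>x F. x \<in> X \<Longrightarrow> F \<subseteq> E \<Longrightarrow> connects F X \<Longrightarrow> g x \<le> sum w F"
  shows "sum g X \<le> ratio (prediction_error X P) * steiner_opt E w X"
proof -
  obtain F where F: "F \<subseteq> E" "connects F X" "steiner_opt E w X = sum w F"
    using steiner_opt_witness[OF X(2)] by blast
  define W where "W = sum w F"
  have W: "0 \<le> W" unfolding W_def using w_sum_nonneg F by blast
  have pack: "(real (card {y \<in> Y. \<theta> \<le> g y}) - 1) * \<theta> \<le> 2 * W" if "Y \<subseteq> X" "0 \<le> \<theta>" for Y \<theta>
    unfolding W_def
  proof (rule packing[OF F(1)])
    show "connects F {y \<in> Y. \<theta> \<le> g y}" using F(2) that unfolding connects_conn by blast
    show "finite {y \<in> Y. \<theta> \<le> g y}" using rev_finite_subset[OF X(1) that(1)] by simp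
    show "0 \<le> \<theta>" by fact
    fix x y assume xy: "x \<in> {y \<in> Y. \<theta> \<le> g y}" "y \<in> {y \<in> Y. \<theta> \<le> g y}" "x \<noteq> y"
    show "\<theta> \<le> td \<theta> x y"
    proof (rule le_td)
      fix F' assume "F' \<subseteq> E" "(x, y) \<in> conn F'"
      then have "min (g x) (g y) \<le> sum w F'" using xy that by (intro sep) auto
      moreover have "\<theta> \<le> min (g x) (g y)" using xy by simp
      ultimately show "\<theta> \<le> sum w F'" by linarith
    qed simp
  qed
  have harm: "sum g Y \<le> W * (3 + 2 * ln (real m))" if "Y \<subseteq> X" "card Y \<le> m + 1" "1 \<le> m" for Y m
  proof (rule harmonic_bound[OF _ that(2,3) W])
    show "finite Y" using rev_finite_subset[OF X(1) that(1)] .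
    show "0 \<le> g y" "g y \<le> W" if "y \<in> Y" for y
      using g solo F that \<open>Y \<subseteq> X\<close> unfolding W_def by auto
  qed (use pack[OF that(1)] in blast)
  define D where "D = card ((X - P) \<union> (P - X))"
  have D: "card (X - P) \<le> D" "card (P - X) \<le> D"
    unfolding D_def using X P by (auto intro: card_mono)
  define \<delta> where "\<delta> = W / (real D + 1)"
  have \<delta>: "0 \<le> \<delta>" "(real D + 1) * \<delta> = W" unfolding \<delta>_def using W by auto
  \<comment> \<open>The balance gives \<open>4 * W + (2 * D + 1) * \<delta>\<close> for predicted
    terminals. The at most \<open>D\<close> others add \<open>D * \<delta>\<close>, and
    \<open>(3 * D + 1) * \<delta> \<le> 3 * W\<close>.\<close>
  have trunc: "(\<Sum>x\<in>X. min (g x) \<delta>) \<le> 7 * W"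
  proof -
    have "(\<Sum>x\<in>X \<inter> P. min (g x) \<delta>) \<le> 4 * W + (2 * real D + 1) * \<delta>"
    proof (cases "X \<inter> P = {}")
      case True
      then show ?thesis using W \<delta> by simp
    next
      case False
      let ?sp = "span_cost (td \<delta>) P"
      have "(\<Sum>c\<in>cls ` (X \<inter> P). gap (td \<delta>) \<delta> P cls c) \<le> 2 * ?sp cls + \<delta>"
        by (rule sum_gap_le) (use P \<delta> td_sym in \<open>auto intro: td_nonneg\<close>)
      moreover have "?sp (id :: nat \<Rightarrow> nat) \<le> 2 * W + real (card (P - X)) * \<delta>"
        unfolding W_def by (rule span_cost_id_le[OF P \<delta>(1) F(1,2) False])
      moreover have "real (card (P - X)) * \<delta> \<le> real D * \<delta>"
        using D \<delta> by (intro mult_right_mono) auto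
      moreover have "(\<Sum>x\<in>X \<inter> P. min (g x) \<delta>) + 2 * ?sp cls
          \<le> 2 * ?sp id + (\<Sum>c\<in>cls ` (X \<inter> P). gap (td \<delta>) \<delta> P cls c)"
        using bal \<delta> unfolding balanced_def by blast
      ultimately show ?thesis by (simp add: algebra_simps)
    qed
    moreover have "(\<Sum>x\<in>X - P. min (g x) \<delta>) \<le> real (card (X - P)) * \<delta>"
      by (rule sum_bounded_above) auto
    moreover have "real (card (X - P)) * \<delta> \<le> real D * \<delta>"
      using D \<delta> by (intro mult_right_mono) auto
    moreover have "(\<Sum>x\<in>X. min (g x) \<delta>) = (\<Sum>x\<in>X \<inter> P. min (g x) \<delta>) + (\<Sum>x\<in>X - P. min (g x) \<delta>)"
      using sum.Int_Diff[OF X(1)] by blast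
    moreover have "(3 * real D + 1) * \<delta> \<le> 3 * W" using \<delta> by (simp add: algebra_simps)
    ultimately show ?thesis by (simp add: algebra_simps)
  qed
  define Y where "Y = {x \<in> X. \<delta> < g x}"
  have Y: "Y \<subseteq> X" "finite Y" unfolding Y_def using X by auto
  have long: "sum g Y \<le> W * (3 + 2 * ln (2 * real D + 2))"
  proof (cases "W = 0")
    \<comment> \<open>Here the threshold is 0 and does not limit the size of \<open>Y\<close>, but
      no single cost exceeds \<open>W = 0\<close>.\<close>
    case True
    have "sum g Y \<le> real (card Y) * W"
      by (rule sum_bounded_above) (use solo F Y W_def in auto)
    then show ?thesis using True by simp
  next
    case False
    have "{y \<in> Y. \<delta> \<le> g y} = Y" unfolding Y_def by auto
    then have "(real (card Y) - 1) * \<delta> \<le> 2 * W" using pack[OF Y(1) \<delta>(1)] by simp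
    also have "\<dots> = (2 * real D + 2) * \<delta>" using \<delta> by (simp add: algebra_simps)
    finally have "real (card Y) - 1 \<le> 2 * real D + 2"
      using False \<delta> W by (cases "\<delta> = 0") auto
    \<comment> \<open>So \<open>m = 2 * D + 2\<close> in the harmonic bound.\<close>
    then have "card Y \<le> (2 * D + 2) + 1" by linarith
    from harm[OF Y(1) this] show ?thesis by (simp add: add.commute)
  qed
  have "sum g X \<le> (\<Sum>x\<in>X. min (g x) \<delta>) + sum g Y"
  proof -
    have "sum g X = sum g (X - Y) + sum g Y" by (rule sum.subset_diff) (use Y X in auto)
    moreover have "sum g (X - Y) \<le> (\<Sum>x\<in>X. min (g x) \<delta>)"
    proof -
      have "sum g (X - Y) = (\<Sum>x\<in>X - Y. min (g x) \<delta>)" by (rule sum.cong) (auto simp: Y_def)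
      also have "\<dots> \<le> (\<Sum>x\<in>X. min (g x) \<delta>)"
        by (rule sum_mono2) (use X g \<delta> in auto)
      finally show ?thesis .
    qed
    ultimately show ?thesis by linarith
  qed
  with trunc long have bound_D: "sum g X \<le> W * (10 + 2 * ln (2 * real D + 2))"
    by (simp add: algebra_simps)
  have "sum g X \<le> W * (10 + 2 * ln (2 * real (prediction_error X P) + 2))"
  proof (cases "D \<le> card X")
    case True
    then show ?thesis using bound_D unfolding prediction_error_def D_def by (simp add: min_def)
  next
    \<comment> \<open>The error is now \<open>card X\<close>, and the harmonic sum over all
      terminals with \<open>m = card X\<close> gives the bound without the prediction.\<close>
    case False
    then have pe: "prediction_error X P = card X" unfolding prediction_error_def D_def by simp
    show ?thesis
    proof (cases "X = {}")
      case True
      then show ?thesis using W by simp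
    next
      case False
      then have c: "1 \<le> card X" using X by (simp add: Suc_leI card_gt_0_iff)
      have "sum g X \<le> W * (3 + 2 * ln (real (card X)))" by (rule harm) (use c in auto)
      also have "\<dots> \<le> W * (10 + 2 * ln (2 * real (card X) + 2))"
        by (intro mult_left_mono W add_mono) (use c in auto)
      finally show ?thesis using pe by simp
    qed
  qed
  then show ?thesis using F unfolding ratio_def W_def by (simp add: mult.commute)
qed

end

section \<open>Partial correctness and running time of programs\<close>

text \<open>Partial correctness only: termination is obtained once for all programs of a certain
  shape.\<close>

definition wlp :: "com \<Rightarrow> state \<Rightarrow> (state \<Rightarrow> bool) \<Rightarrow> bool" where
  "wlp c s Q \<longleftrightarrow> (\<forall>t s'. exec c s t s' \<longrightarrow> Q s')"

inductive_cases SkipE: "exec Skip s t s'"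
inductive_cases NAssignE: "exec (NAssign a i j e) s t s'"
inductive_cases RAssignE: "exec (RAssign a i j e) s t s'"
inductive_cases SeqE: "exec (Seq c d) s t s'"
inductive_cases IfE: "exec (If b c d) s t s'"

lemma wlp_Skip [simp]: "wlp Skip s Q = Q s"
  unfolding wlp_def by (auto elim: SkipE intro: exec.intros)

lemma wlp_NAssign [simp]:
  "wlp (NAssign a i j e) s Q =
     Q (s\<lparr>nmem := upd (nmem s) a (nval i s) (nval j s) (nval e s)\<rparr>)"
  unfolding wlp_def by (auto elim: NAssignE intro: exec.intros)

lemma wlp_RAssign [simp]:
  "wlp (RAssign a i j e) s Q =
     Q (s\<lparr>rmem := upd (rmem s) a (nval i s) (nval j s) (rval e s)\<rparr>)"
  unfolding wlp_def by (auto elim: RAssignE intro: exec.intros)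

lemma wlp_Seq [simp]: "wlp (Seq c d) s Q = wlp c s (\<lambda>s'. wlp d s' Q)"
  unfolding wlp_def by (blast elim: SeqE intro: exec.Seq)

lemma wlp_If [simp]: "wlp (If b c d) s Q = (if bval b s then wlp c s Q else wlp d s Q)"
  unfolding wlp_def by (auto elim: IfE intro: exec.IfTrue exec.IfFalse)

lemma upd_apply: "upd m a i j x b k l = (if b = a \<and> k = i \<and> l = j then x else m b k l)"
  unfolding upd_def by auto

lemma upd_other [simp]: "b \<noteq> a \<Longrightarrow> upd m a i j x b = m b"
  unfolding upd_def by auto

section \<open>The arrays that a program can change\<close>

fun nw :: "com \<Rightarrow> string set" where
  "nw Skip = {}"
| "nw (NAssign a i j e) = {a}"
| "nw (RAssign a i j e) = {}"
| "nw (Seq c d) = nw c \<union> nw d"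
| "nw (If b c d) = nw c \<union> nw d"
| "nw (While b c) = nw c"

fun rw :: "com \<Rightarrow> string set" where
  "rw Skip = {}"
| "rw (NAssign a i j e) = {}"
| "rw (RAssign a i j e) = {a}"
| "rw (Seq c d) = rw c \<union> rw d"
| "rw (If b c d) = rw c \<union> rw d"
| "rw (While b c) = rw c"

definition frame :: "com \<Rightarrow> state \<Rightarrow> state \<Rightarrow> bool" where
  "frame c s s' \<longleftrightarrow> (\<forall>a. a \<notin> nw c \<longrightarrow> nmem s' a = nmem s a) \<and> (\<forall>a. a \<notin> rw c \<longrightarrow> rmem s' a = rmem s a)"

lemma frame_exec: "exec c s t s' \<Longrightarrow> frame c s s'"
  by (induction rule: exec.induct) (auto simp: frame_def)

lemma frame_nmem: "frame c s s' \<Longrightarrow> a \<notin> nw c \<Longrightarrow> nmem s' a = nmem s a"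
  by (simp add: frame_def)

lemma frame_rmem: "frame c s s' \<Longrightarrow> a \<notin> rw c \<Longrightarrow> rmem s' a = rmem s a"
  by (simp add: frame_def)

text \<open>The consequence rule also supplies the frame, so that specifications need not list the
  arrays that stay unchanged.\<close>

lemma wlp_cons:
  "wlp c s Q \<Longrightarrow> (\<And>s'. Q s' \<Longrightarrow> frame c s s' \<Longrightarrow> Q' s') \<Longrightarrow> wlp c s Q'"
  unfolding wlp_def using frame_exec by blast

section \<open>Counting loops\<close>

abbreviation var :: "string \<Rightarrow> nexp" where
  "var a \<equiv> Cell a (Num 0) (Num 0)"

abbreviation ent :: "string \<Rightarrow> nexp \<Rightarrow> nexp" where
  "ent a i \<equiv> Cell a i (Num 0)"

abbreviation nset :: "string \<Rightarrow> nexp \<Rightarrow> com" where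
  "nset a e \<equiv> NAssign a (Num 0) (Num 0) e"

abbreviation aset :: "string \<Rightarrow> nexp \<Rightarrow> nexp \<Rightarrow> com" where
  "aset a i e \<equiv> NAssign a i (Num 0) e"

abbreviation rvar :: "string \<Rightarrow> rexp" where
  "rvar a \<equiv> RCell a (Num 0) (Num 0)"

abbreviation rent :: "string \<Rightarrow> nexp \<Rightarrow> rexp" where
  "rent a i \<equiv> RCell a i (Num 0)"

abbreviation rset :: "string \<Rightarrow> rexp \<Rightarrow> com" where
  "rset a e \<equiv> RAssign a (Num 0) (Num 0) e"

abbreviation raset :: "string \<Rightarrow> nexp \<Rightarrow> rexp \<Rightarrow> com" where
  "raset a i e \<equiv> RAssign a i (Num 0) e"

abbreviation nz :: "nexp \<Rightarrow> bexp" where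
  "nz e \<equiv> NLess (Num 0) e"

abbreviation bor :: "bexp \<Rightarrow> bexp \<Rightarrow> bexp" where
  "bor b c \<equiv> BNot (BAnd (BNot b) (BNot c))"

abbreviation neq :: "nexp \<Rightarrow> nexp \<Rightarrow> bexp" where
  "neq e f \<equiv> bor (NLess e f) (NLess f e)"

definition For :: "string \<Rightarrow> com \<Rightarrow> com" where
  "For i c = Seq (nset i (Num 0))
     (While (NLess (var i) (var ''n'')) (Seq c (nset i (Add (var i) (Num 1)))))"

lemma nw_For [simp]: "nw (For i c) = insert i (nw c)"
  by (auto simp: For_def)

lemma rw_For [simp]: "rw (For i c) = rw c"
  by (auto simp: For_def)

lemma exec_While_induct [consumes 1, case_names WhileFalse WhileTrue]:
  assumes "exec (While b c) s t s'"
    and "\<And>s. \<not> bval b s \<Longrightarrow> P s s"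
    and "\<And>s t s' t' s''. bval b s \<Longrightarrow> exec c s t s' \<Longrightarrow> exec (While b c) s' t' s'' \<Longrightarrow> P s' s'' \<Longrightarrow> P s s''"
  shows "P s s'"
  using assms(1) by (induction "While b c" s t s' rule: exec.induct) (use assms(2,3) in blast)+

text \<open>The invariant is stated for the memory after the counter has been incremented, hence the
  update in the postcondition of \<open>step\<close>. The frame relates each iteration to the memory
  before the loop, which keeps invariants short.\<close>

lemma wlp_For:
  fixes I :: "nat \<Rightarrow> state \<Rightarrow> bool"
  assumes i: "i \<notin> nw c" "''n'' \<notin> nw c" "i \<noteq> ''n''" and N: "nmem s ''n'' 0 0 = N"
    and start: "\<And>s'. s' = s\<lparr>nmem := upd (nmem s) i 0 0 0\<rparr> \<Longrightarrow> I 0 s'"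
    and step: "\<And>k s'. k < N \<Longrightarrow> I k s' \<Longrightarrow> nmem s' i 0 0 = k \<Longrightarrow> nmem s' ''n'' 0 0 = N \<Longrightarrow>
      frame (For i c) s s' \<Longrightarrow> wlp c s' (\<lambda>s''. I (Suc k) (s''\<lparr>nmem := upd (nmem s'') i 0 0 (Suc k)\<rparr>))"
    and final: "\<And>s'. I N s' \<Longrightarrow> frame (For i c) s s' \<Longrightarrow> Q s'"
  shows "wlp (For i c) s Q"
  unfolding wlp_def
proof (intro allI impI)
  fix t s' assume ex: "exec (For i c) s t s'"
  let ?b = "NLess (var i) (var ''n'')" and ?c = "Seq c (nset i (Add (var i) (Num 1)))"
  define s1 where "s1 = s\<lparr>nmem := upd (nmem s) i 0 0 0\<rparr>"
  from ex obtain t1 where loop: "exec (While ?b ?c) s1 t1 s'"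
    unfolding For_def s1_def by (auto elim!: SeqE NAssignE)
  have "\<forall>k\<le>N. I k r \<longrightarrow> nmem r i 0 0 = k \<longrightarrow> nmem r ''n'' 0 0 = N \<longrightarrow> frame (For i c) s r \<longrightarrow> I N r'"
    if "exec (While ?b ?c) r t1 r'" for r r' t1
    using that
  proof (induction rule: exec_While_induct)
    case (WhileFalse r)
    then show ?case by auto
  next
    case (WhileTrue r t r' t' r'')
    show ?case
    proof (intro allI impI)
      fix k assume k: "k \<le> N" "I k r" "nmem r i 0 0 = k" "nmem r ''n'' 0 0 = N" "frame (For i c) s r"
      have "k < N" using WhileTrue.hyps(1) k by simp
      from WhileTrue.hyps(2) obtain t2 r2 where r2: "exec c r t2 r2"
        "r' = r2\<lparr>nmem := upd (nmem r2) i 0 0 (Suc (nmem r2 i 0 0))\<rparr>"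
        by (auto elim!: SeqE NAssignE)
      from frame_exec[OF r2(1)] have fr: "frame c r r2" .
      have eq: "nmem r2 i 0 0 = k" "nmem r2 ''n'' 0 0 = N" using frame_nmem[OF fr] i k by auto
      have "I (Suc k) r'"
        using step[OF \<open>k < N\<close> k(2-5)] r2 eq unfolding wlp_def by auto
      moreover have "nmem r' i 0 0 = Suc k" "nmem r' ''n'' 0 0 = N"
        using r2 eq i by (auto simp: upd_apply)
      moreover have "frame (For i c) s r'" using fr k(5) r2 i unfolding frame_def by auto
      ultimately show "I N r''" using WhileTrue.IH \<open>k < N\<close> by auto
    qed
  qed
  from this[OF loop] have "I N s'"
    using start[of s1] N i by (auto simp: s1_def frame_def upd_apply)
  then show "Q s'" using final frame_exec[OF ex] by blast
qed

text \<open>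
  Programs whose only loops are \<open>For\<close> loops halt in polynomial time on every memory, so that
  only partial correctness of such programs is at stake.
\<close>

inductive bounded :: "com \<Rightarrow> bool" where
  "bounded Skip"
| "a \<noteq> ''n'' \<Longrightarrow> bounded (NAssign a i j e)"
| "bounded (RAssign a i j r)"
| "bounded c \<Longrightarrow> bounded d \<Longrightarrow> bounded (Seq c d)"
| "bounded c \<Longrightarrow> bounded d \<Longrightarrow> bounded (If b c d)"
| "bounded c \<Longrightarrow> i \<notin> nw c \<Longrightarrow> i \<noteq> ''n'' \<Longrightarrow> bounded (For i c)"

lemma bounded_n: "bounded c \<Longrightarrow> ''n'' \<notin> nw c"
  by (induction rule: bounded.induct) auto

text \<open>Each iteration costs three steps besides its body: the test, the sequencing and the
  increment. The final test and the initialization cost three more in total.\<close>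

lemma For_halts:
  assumes i: "i \<notin> nw c" "i \<noteq> ''n''" "''n'' \<notin> nw c"
    and c: "\<And>s. nmem s ''n'' 0 0 = N \<Longrightarrow> \<exists>t\<le>T. \<exists>s'. exec c s t s'"
    and N: "nmem s ''n'' 0 0 = N"
  shows "\<exists>t\<le>3 + N * (T + 3). \<exists>s'. exec (For i c) s t s'"
proof -
  let ?b = "NLess (var i) (var ''n'')" and ?c = "Seq c (nset i (Add (var i) (Num 1)))"
  have loop: "\<exists>t\<le>1 + m * (T + 3). \<exists>s'. exec (While ?b ?c) s t s'"
    if "nmem s ''n'' 0 0 = N" "nmem s i 0 0 + m = N" for m s
    using that
  proof (induction m arbitrary: s)
    case 0
    then show ?case using exec.WhileFalse[of ?b s ?c] by auto
  next
    case (Suc m)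
    from c[OF Suc.prems(1)] obtain t s' where s': "t \<le> T" "exec c s t s'" by blast
    let ?s = "s'\<lparr>nmem := upd (nmem s') i 0 0 (Suc (nmem s' i 0 0))\<rparr>"
    have eq: "nmem s' i = nmem s i" "nmem s' ''n'' = nmem s ''n''"
      using frame_nmem[OF frame_exec[OF s'(2)]] i by auto
    have "exec ?c s (1 + t + 1) ?s"
      using exec.Seq[OF s'(2) exec.NAssign[of i "Num 0" "Num 0" "Add (var i) (Num 1)" s']] by simp
    moreover obtain t' s'' where "t' \<le> 1 + m * (T + 3)" "exec (While ?b ?c) ?s t' s''"
      using Suc.IH[of ?s] Suc.prems i eq by (auto simp: upd_apply)
    moreover have "bval ?b s" using Suc.prems by auto
    ultimately have "exec (While ?b ?c) s (1 + (1 + t + 1) + t') s''" by (blast intro: exec.WhileTrue)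
    then show ?case using \<open>t \<le> T\<close> \<open>t' \<le> _\<close> by (intro exI[of _ "1 + (1 + t + 1) + t'"]) auto
  qed
  obtain t s' where ts: "t \<le> 1 + N * (T + 3)"
    "exec (While ?b ?c) (s\<lparr>nmem := upd (nmem s) i 0 0 0\<rparr>) t s'"
    using loop[of "s\<lparr>nmem := upd (nmem s) i 0 0 0\<rparr>" N] N i by (auto simp: upd_apply)
  have "exec (For i c) s (1 + 1 + t) s'"
    unfolding For_def
    by (rule exec.Seq[OF exec.NAssign]) (use ts in simp)
  then show ?thesis using ts by (intro exI[of _ "1 + 1 + t"]) auto
qed

text \<open>Structural induction. As no such program writes to \<open>n\<close>, the bounds of all
  subprograms are evaluated at the same number.\<close>

lemma bounded_halts:
  assumes "bounded c"
  shows "\<exists>p :: nat poly. \<forall>s. \<exists>t\<le>poly p (nmem s ''n'' 0 0). \<exists>s'. exec c s t s'"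
  using assms
proof induction
  case 1
  show ?case by (intro exI[of _ "[:1:]"] allI exI[of _ 1] conjI exI, simp, rule exec.Skip)
next
  case (2 a i j e)
  show ?case by (intro exI[of _ "[:1:]"] allI exI[of _ 1] conjI exI, simp, rule exec.NAssign)
next
  case (3 a i j r)
  show ?case by (intro exI[of _ "[:1:]"] allI exI[of _ 1] conjI exI, simp, rule exec.RAssign)
next
  case (4 c d)
  then obtain p q :: "nat poly" where
    p: "\<And>s. \<exists>t\<le>poly p (nmem s ''n'' 0 0). \<exists>s'. exec c s t s'" and
    q: "\<And>s. \<exists>t\<le>poly q (nmem s ''n'' 0 0). \<exists>s'. exec d s t s'" by metis
  show ?case
  proof (intro exI[of _ "[:1:] + p + q"] allI)
    fix s
    from p obtain t s' where t: "t \<le> poly p (nmem s ''n'' 0 0)" "exec c s t s'" by blast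
    from q obtain t' s'' where t': "t' \<le> poly q (nmem s' ''n'' 0 0)" "exec d s' t' s''" by blast
    have "nmem s' ''n'' = nmem s ''n''"
      using frame_nmem[OF frame_exec[OF t(2)] bounded_n[OF 4(1)]] .
    then show "\<exists>t\<le>poly ([:1:] + p + q) (nmem s ''n'' 0 0). \<exists>s'. exec (Seq c d) s t s'"
      using exec.Seq[OF t(2) t'(2)] t t' by (intro exI[of _ "1 + t + t'"]) auto
  qed
next
  case (5 c d b)
  then obtain p q :: "nat poly" where
    p: "\<And>s. \<exists>t\<le>poly p (nmem s ''n'' 0 0). \<exists>s'. exec c s t s'" and
    q: "\<And>s. \<exists>t\<le>poly q (nmem s ''n'' 0 0). \<exists>s'. exec d s t s'" by metis
  show ?case
  proof (intro exI[of _ "[:1:] + p + q"] allI)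
    fix s
    from p obtain t s' where t: "t \<le> poly p (nmem s ''n'' 0 0)" "exec c s t s'" by blast
    from q obtain t' s'' where t': "t' \<le> poly q (nmem s ''n'' 0 0)" "exec d s t' s''" by blast
    show "\<exists>t\<le>poly ([:1:] + p + q) (nmem s ''n'' 0 0). \<exists>s'. exec (If b c d) s t s'"
    proof (cases "bval b s")
      case True
      show ?thesis using exec.IfTrue[OF True t(2)] t by (intro exI[of _ "1 + t"]) auto
    next
      case False
      show ?thesis using exec.IfFalse[OF False t'(2)] t' by (intro exI[of _ "1 + t'"]) auto
    qed
  qed
next
  case (6 c i)
  then obtain p :: "nat poly" where
    p: "\<And>s. \<exists>t\<le>poly p (nmem s ''n'' 0 0). \<exists>s'. exec c s t s'" by metis
  show ?case
  proof (intro exI[of _ "[:3:] + [:0, 1:] * (p + [:3:])"] allI)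
    fix s
    show "\<exists>t\<le>poly ([:3:] + [:0, 1:] * (p + [:3:])) (nmem s ''n'' 0 0). \<exists>s'. exec (For i c) s t s'"
      using For_halts[OF 6(2,3) bounded_n[OF 6(1)], of "nmem s ''n'' 0 0" "poly p (nmem s ''n'' 0 0)" s] p
      by simp metis
  qed
qed

lemma poly_nat_mono:
  fixes p :: "nat poly"
  shows "x \<le> y \<Longrightarrow> poly p x \<le> poly p y"
  by (induction p) (auto intro: add_mono mult_mono)

lemma bounded_polynomial_time:
  assumes "bounded c" "bounded d"
  shows "polynomial_time (c, d)"
proof -
  obtain p q :: "nat poly" where
    p: "\<And>s. \<exists>t\<le>poly p (nmem s ''n'' 0 0). \<exists>s'. exec c s t s'" and
    q: "\<And>s. \<exists>t\<le>poly q (nmem s ''n'' 0 0). \<exists>s'. exec d s t s'"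
    using bounded_halts assms by metis
  have serve: "\<exists>t\<le>length xs * poly q N. \<exists>Fs. serve d s xs t Fs" if "nmem s ''n'' 0 0 = N" for s xs N
    using that
  proof (induction xs arbitrary: s)
    case Nil
    then show ?case using serve.Nil by auto
  next
    case (Cons x xs)
    have "nmem (arrive x s) ''n'' 0 0 = N" using Cons.prems by (simp add: arrive_def)
    with q[of "arrive x s"] obtain t s' where t: "t \<le> poly q N" "exec d (arrive x s) t s'" by auto
    have "nmem s' ''n'' 0 0 = N"
      using frame_nmem[OF frame_exec[OF t(2)] bounded_n[OF assms(2)]] \<open>nmem (arrive x s) ''n'' 0 0 = N\<close>
      by simp
    from Cons.IH[OF this] obtain t' Fs where t': "t' \<le> length xs * poly q N" "serve d s' xs t' Fs" by blast
    from serve.Cons[OF t(2) t'(2)] t t' show ?case by (intro exI[of _ "t + t'"]) auto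
  qed
  show ?thesis
    unfolding polynomial_time_def
  \<comment> \<open>The factor \<open>[:0, 1:]\<close> is the identity polynomial; at
    \<open>n + length xs\<close> it dominates the number of requests.\<close>
  proof (intro exI[of _ "p + [:0, 1:] * q"] allI impI)
    fix n E w Xhat xs
    let ?s = "input_state n E w Xhat"
    have n: "nmem ?s ''n'' 0 0 = n" by (simp add: input_state_def)
    from p[of ?s] n obtain t s where t: "t \<le> poly p n" "exec c ?s t s" by auto
    have "nmem s ''n'' 0 0 = n"
      using frame_nmem[OF frame_exec[OF t(2)] bounded_n[OF assms(1)]] n by simp
    from serve[OF this, of xs] obtain t' Fs where t': "t' \<le> length xs * poly q n" "serve d s xs t' Fs" by blast
    have "t + t' \<le> poly p (n + length xs) + (n + length xs) * poly q (n + length xs)"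
      by (rule add_mono[OF order_trans[OF t(1)] order_trans[OF t'(1)]])
        (auto intro!: poly_nat_mono mult_mono)
    then show "\<exists>T Fs. online_run (c, d) n E w Xhat xs T Fs \<and> T \<le> poly (p + [:0, 1:] * q) (n + length xs)"
      unfolding online_run_def using t t' by (intro exI[of _ "t + t'"] exI[of _ Fs]) auto
  qed
qed

section \<open>The algorithm\<close>

text \<open>A running minimum over the candidates in \<open>J\<close>, where \<open>f = 0\<close> means that there was none.\<close>

definition runmin :: "('i \<Rightarrow> bool) \<Rightarrow> ('i \<Rightarrow> real) \<Rightarrow> 'i set \<Rightarrow> nat \<Rightarrow> real \<Rightarrow> 'i \<Rightarrow> bool" where
  "runmin C val J f m i \<longleftrightarrow>
     (if f = 0 then \<forall>j\<in>J. \<not> C j else C i \<and> m = val i \<and> (\<forall>j\<in>J. C j \<longrightarrow> m \<le> val j))"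

lemma runmin_empty: "runmin C val {} 0 m i"
  by (simp add: runmin_def)

lemma runmin_take:
  "runmin C val J f m i \<Longrightarrow> C j \<Longrightarrow> f = 0 \<or> val j < m \<Longrightarrow> runmin C val (insert j J) (Suc 0) (val j) j"
  by (fastforce simp: runmin_def split: if_splits)

lemma runmin_skip:
  "runmin C val J f m i \<Longrightarrow> \<not> (C j \<and> (f = 0 \<or> val j < m)) \<Longrightarrow> runmin C val (insert j J) f m i"
  by (fastforce simp: runmin_def split: if_splits)

text \<open>
  The array \<open>cls\<close> holds the labels of the classes, \<open>arr\<close> marks the terminals that have arrived, and
  \<open>bud\<close> is the budget that is left. Dijkstra's algorithm from the class of \<open>req\<close> marks \<open>seen\<close> vertices
  and records \<open>dist\<close> and the parent \<open>par\<close>; \<open>anc v u\<close> is nonzero iff \<open>u\<close> is a vertex other than the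
  root on the tree path to \<open>v\<close>, so that a path is bought by scanning a row of \<open>anc\<close>. The flag \<open>fnd\<close>
  tells whether \<open>best\<close>, \<open>p\<close> and \<open>q\<close> hold the result of a search for a minimum.
\<close>

definition init_prog :: com where
  "init_prog = For ''v'' (Seq
     (If (neq (ent ''cls'' (var ''v'')) (ent ''cls'' (var ''req'')))
       (aset ''seen'' (var ''v'') (Num 0)) (aset ''seen'' (var ''v'') (Num 1)))
     (Seq (raset ''dist'' (var ''v'') RZero)
       (For ''u'' (NAssign ''anc'' (var ''v'') (var ''u'') (Num 0)))))"

definition scan_prog :: com where
  "scan_prog = Seq (nset ''fnd'' (Num 0)) (For ''a'' (For ''b''
     (If (BAnd (nz (ent ''seen'' (var ''a''))) (BAnd (BNot (nz (ent ''seen'' (var ''b''))))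
           (BAnd (nz (Cell ''adj'' (var ''a'') (var ''b'')))
             (bor (BNot (nz (var ''fnd'')))
               (RLess (RAdd (rent ''dist'' (var ''a'')) (RCell ''w'' (var ''a'') (var ''b''))) (rvar ''best''))))))
       (Seq (nset ''fnd'' (Num 1))
         (Seq (rset ''best'' (RAdd (rent ''dist'' (var ''a'')) (RCell ''w'' (var ''a'') (var ''b''))))
           (Seq (nset ''p'' (var ''a'')) (nset ''q'' (var ''b'')))))
       Skip)))"

text \<open>One round of Dijkstra's algorithm per vertex. The \<open>anc\<close> row of a new vertex
  is that of its parent plus its own entry; rows of roots stay zero.\<close>

definition settle_prog :: com where
  "settle_prog = For ''k'' (Seq scan_prog (If (nz (var ''fnd''))
     (Seq (For ''u'' (NAssign ''anc'' (var ''q'') (var ''u'') (Cell ''anc'' (var ''p'') (var ''u''))))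
       (Seq (NAssign ''anc'' (var ''q'') (var ''q'') (Num 1))
         (Seq (raset ''dist'' (var ''q'') (rvar ''best''))
           (Seq (aset ''par'' (var ''q'') (var ''p''))
             (aset ''seen'' (var ''q'') (Num 1))))))
     Skip))"

definition nearest_prog :: "bexp \<Rightarrow> com" where
  "nearest_prog tb = Seq (nset ''fnd'' (Num 0)) (For ''v''
     (If (BAnd tb (BAnd (nz (ent ''seen'' (var ''v'')))
           (bor (BNot (nz (var ''fnd''))) (RLess (rent ''dist'' (var ''v'')) (rvar ''best'')))))
       (Seq (nset ''fnd'' (Num 1))
         (Seq (rset ''best'' (rent ''dist'' (var ''v''))) (nset ''q'' (var ''v''))))
       Skip))"

definition search_prog :: "bexp \<Rightarrow> com" where
  "search_prog tb = Seq init_prog (Seq settle_prog (nearest_prog tb))"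

definition buy_prog :: com where
  "buy_prog = For ''u'' (If (nz (Cell ''anc'' (var ''q'') (var ''u'')))
     (NAssign ''buy'' (var ''u'') (ent ''par'' (var ''u'')) (Num 1)) Skip)"

text \<open>The old label is saved in \<open>c\<close> first, because the loop overwrites the label
  of \<open>q\<close> itself.\<close>

definition relabel_prog :: com where
  "relabel_prog = Seq (nset ''c'' (ent ''cls'' (var ''q'')))
     (For ''v'' (If (neq (ent ''cls'' (var ''v'')) (var ''c'')) Skip
       (aset ''cls'' (var ''v'') (ent ''cls'' (var ''req'')))))"

definition terminal_test :: bexp where
  "terminal_test = nz (ent ''arr'' (var ''v''))"

definition growth_test :: bexp where
  "growth_test = BAnd (nz (ent ''pred'' (var ''v'')))
     (neq (ent ''cls'' (var ''v'')) (ent ''cls'' (var ''req'')))"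

definition grow_prog :: com where
  "grow_prog = Seq (search_prog growth_test)
     (If (BAnd (nz (var ''fnd'')) (RLess (rvar ''best'') (rvar ''bud'')))
       (Seq buy_prog (Seq (rset ''bud'' (RSub (rvar ''bud'') (rvar ''best''))) relabel_prog))
       Skip)"

definition greedy_prog :: com where
  "greedy_prog = Seq (search_prog terminal_test)
     (Seq (If (nz (var ''fnd'')) (Seq buy_prog (rset ''bud'' (rvar ''best''))) (rset ''bud'' RZero))
       (aset ''arr'' (var ''req'') (Num 1)))"

text \<open>The growing loop runs \<open>n\<close> times: a round either enlarges the class or finds
  that growth has ended.\<close>

definition serve_prog :: com where
  "serve_prog = If (nz (ent ''arr'' (var ''req''))) Skip
     (Seq greedy_prog (If (nz (ent ''pred'' (var ''req''))) (For ''g'' grow_prog) Skip))"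

definition prepare_prog :: com where
  "prepare_prog = For ''v'' (aset ''cls'' (var ''v'') (var ''v''))"

definition steiner_alg :: online_alg where
  "steiner_alg = (prepare_prog, serve_prog)"

lemmas prog_defs = init_prog_def scan_prog_def settle_prog_def nearest_prog_def search_prog_def
  buy_prog_def relabel_prog_def grow_prog_def greedy_prog_def serve_prog_def prepare_prog_def

lemma steiner_alg_polynomial_time: "polynomial_time steiner_alg"
  unfolding steiner_alg_def
  by (rule bounded_polynomial_time; unfold prog_defs; (rule bounded.intros | simp)+)

lemma nw_search: "nw (search_prog tb) =
    {''v'', ''seen'', ''u'', ''anc'', ''k'', ''fnd'', ''a'', ''b'', ''p'', ''q'', ''par''}"
  by (auto simp: prog_defs)

lemma rw_search: "rw (search_prog tb) = {''dist'', ''best''}"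
  by (auto simp: prog_defs)

lemma wlp_init:
  assumes n: "nmem s ''n'' 0 0 = n"
  shows "wlp init_prog s (\<lambda>s'. \<forall>v<n.
    nmem s' ''seen'' v 0 = (if nmem s ''cls'' v 0 = nmem s ''cls'' (nmem s ''req'' 0 0) 0 then 1 else 0) \<and>
    rmem s' ''dist'' v 0 = 0 \<and> (\<forall>u<n. nmem s' ''anc'' v u = 0))"
    (is "wlp _ s (\<lambda>s'. \<forall>v<n. ?I v s')")
  unfolding init_prog_def
proof (rule wlp_For[where N = n and I = "\<lambda>k s'. \<forall>v<k. ?I v s'"])
  fix k s'
  assume k: "k < n" "\<forall>v<k. ?I v s'" "nmem s' ''v'' 0 0 = k" "nmem s' ''n'' 0 0 = n"
    and fr: "frame (For ''v'' (Seq
     (If (neq (ent ''cls'' (var ''v'')) (ent ''cls'' (var ''req'')))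
       (aset ''seen'' (var ''v'') (Num 0)) (aset ''seen'' (var ''v'') (Num 1)))
     (Seq (raset ''dist'' (var ''v'') RZero)
       (For ''u'' (NAssign ''anc'' (var ''v'') (var ''u'') (Num 0)))))) s s'"
  have eq: "nmem s' ''cls'' = nmem s ''cls''" "nmem s' ''req'' = nmem s ''req''"
    using frame_nmem[OF fr, of "''cls''"] frame_nmem[OF fr, of "''req''"] by simp_all
  have row: "wlp (For ''u'' (NAssign ''anc'' (var ''v'') (var ''u'') (Num 0))) r
      (\<lambda>r'. nmem r' ''seen'' = nmem r ''seen'' \<and> rmem r' = rmem r \<and>
         (\<forall>v u. nmem r' ''anc'' v u = (if v = k \<and> u < n then 0 else nmem r ''anc'' v u)))"
    if "nmem r ''v'' 0 0 = k" "nmem r ''n'' 0 0 = n" for r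
  proof (rule wlp_For[where N = n and I = "\<lambda>l r'. nmem r' ''v'' 0 0 = k \<and> nmem r' ''seen'' = nmem r ''seen'' \<and>
      rmem r' = rmem r \<and> (\<forall>v u. nmem r' ''anc'' v u = (if v = k \<and> u < l then 0 else nmem r ''anc'' v u))"])
  qed (use that in \<open>auto simp: upd_apply less_Suc_eq\<close>)
  show "wlp (Seq
     (If (neq (ent ''cls'' (var ''v'')) (ent ''cls'' (var ''req'')))
       (aset ''seen'' (var ''v'') (Num 0)) (aset ''seen'' (var ''v'') (Num 1)))
     (Seq (raset ''dist'' (var ''v'') RZero)
       (For ''u'' (NAssign ''anc'' (var ''v'') (var ''u'') (Num 0))))) s'
     (\<lambda>s''. \<forall>v<Suc k. ?I v (s''\<lparr>nmem := upd (nmem s'') ''v'' 0 0 (Suc k)\<rparr>))"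
    using k eq
    by (auto intro!: wlp_cons[OF row] simp: upd_apply less_Suc_eq)
qed (use n in auto)

section \<open>Correctness of the searches\<close>

text \<open>Entries of \<open>buy\<close> are set and never cleared, so the purchase read off from
  the memory includes all earlier orders.\<close>

lemma wlp_buy:
  assumes n: "nmem s ''n'' 0 0 = n"
  shows "wlp buy_prog s (\<lambda>s'. purchase s' = purchase s \<union>
    {{u, nmem s ''par'' u 0} | u. u < n \<and> nmem s ''anc'' (nmem s ''q'' 0 0) u \<noteq> 0})"
  unfolding buy_prog_def
proof (rule wlp_For[where N = n and I = "\<lambda>k s'. purchase s' = purchase s \<union>
    {{u, nmem s ''par'' u 0} | u. u < k \<and> nmem s ''anc'' (nmem s ''q'' 0 0) u \<noteq> 0}"], goal_cases)
  case (6 k s')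
  note fr = frame_nmem[OF 6(5)]
  have eq: "nmem s' ''anc'' = nmem s ''anc''" "nmem s' ''q'' = nmem s ''q''" "nmem s' ''par'' = nmem s ''par''"
    using fr[of "''anc''"] fr[of "''q''"] fr[of "''par''"] by simp_all
  have pur: "purchase (r\<lparr>nmem := upd (nmem r) ''buy'' a b (Suc 0)\<rparr>) = insert {a, b} (purchase r)"
    "purchase (r\<lparr>nmem := upd (nmem r) ''u'' 0 0 c\<rparr>) = purchase r" for r a b c
    unfolding purchase_def by (auto simp: upd_apply)
  show ?case
    using 6(2,3) eq by (auto simp: pur less_Suc_eq)
qed (use n in \<open>auto simp: purchase_def\<close>)

lemma wlp_relabel:
  assumes n: "nmem s ''n'' 0 0 = n" and neq: "nmem s ''cls'' (nmem s ''q'' 0 0) 0 \<noteq> nmem s ''cls'' (nmem s ''req'' 0 0) 0"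
  shows "wlp relabel_prog s (\<lambda>s'. \<forall>v<n. nmem s' ''cls'' v 0 =
    (if nmem s ''cls'' v 0 = nmem s ''cls'' (nmem s ''q'' 0 0) 0
     then nmem s ''cls'' (nmem s ''req'' 0 0) 0 else nmem s ''cls'' v 0))"
    (is "wlp _ s (\<lambda>s'. \<forall>v<n. nmem s' ''cls'' v 0 = ?new v)")
proof -
  define c where "c = nmem s ''cls'' (nmem s ''q'' 0 0) 0"
  define x where "x = nmem s ''req'' 0 0"
  show ?thesis
    unfolding relabel_prog_def wlp_Seq wlp_NAssign
  proof (rule wlp_For[where N = n and I = "\<lambda>k s'. \<forall>v. nmem s' ''cls'' v 0 =
      (if v < k \<and> nmem s ''cls'' v 0 = c then nmem s ''cls'' x 0 else nmem s ''cls'' v 0)"], goal_cases)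
    case (6 k s')
    note fr = frame_nmem[OF 6(5)]
    have eq: "nmem s' ''c'' 0 0 = c" "nmem s' ''req'' = nmem s ''req''"
      using fr[of "''c''"] fr[of "''req''"] by (simp_all add: upd_apply c_def)
    have x: "nmem s' ''cls'' x 0 = nmem s ''cls'' x 0" using 6(2) by simp
    show ?case
      using 6(2,3) eq x by (auto simp: upd_apply less_Suc_eq x_def)
  qed (use n in \<open>auto simp: upd_apply c_def x_def\<close>)
qed

text \<open>The search is generic in the test \<open>tb\<close>. The hypothesis asks that
  \<open>tb\<close> decides membership in \<open>T\<close> on all memories that differ from
  \<open>s\<close> only in what the loop writes.\<close>

lemma wlp_nearest:
  assumes n: "nmem s ''n'' 0 0 = n"
    and T: "\<And>s' v. v < n \<Longrightarrow> nmem s' ''v'' 0 0 = v \<Longrightarrow>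
      (\<And>a. a \<notin> {''v'', ''fnd'', ''q''} \<Longrightarrow> nmem s' a = nmem s a) \<Longrightarrow> bval tb s' \<longleftrightarrow> v \<in> T"
  shows "wlp (nearest_prog tb) s (\<lambda>s'. runmin (\<lambda>v. v \<in> T \<and> nmem s ''seen'' v 0 \<noteq> 0)
    (\<lambda>v. rmem s ''dist'' v 0) {..<n} (nmem s' ''fnd'' 0 0) (rmem s' ''best'' 0 0) (nmem s' ''q'' 0 0))"
    (is "wlp _ _ (\<lambda>s'. runmin ?C ?val _ _ _ _)")
  unfolding nearest_prog_def wlp_Seq wlp_NAssign
proof (rule wlp_For[where N = n and I = "\<lambda>k s'. runmin ?C ?val {..<k}
    (nmem s' ''fnd'' 0 0) (rmem s' ''best'' 0 0) (nmem s' ''q'' 0 0)"], goal_cases)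
  case (6 k s')
  note fr = frame_nmem[OF 6(5)] and frr = frame_rmem[OF 6(5)]
  have eq: "nmem s' a = nmem s a" if "a \<notin> {''v'', ''fnd'', ''q''}" for a
    using fr[of a] that by simp
  have eq2: "nmem s' ''seen'' = nmem s ''seen''" "rmem s' ''dist'' = rmem s ''dist''"
    using eq[of "''seen''"] frr[of "''dist''"] by simp_all
  have tb: "bval tb s' \<longleftrightarrow> k \<in> T" by (rule T[OF 6(1,3)]) (rule eq)
  note inv = 6(2)
  show ?case
  proof (cases "?C k \<and> (nmem s' ''fnd'' 0 0 = 0 \<or> ?val k < rmem s' ''best'' 0 0)")
    case True
    then show ?thesis
      using runmin_take[OF inv, of k] 6(3) tb eq2 by (auto simp: upd_apply lessThan_Suc)
  next
    case False
    then show ?thesis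
      using runmin_skip[OF inv, of k] 6(3) tb eq2 by (auto simp: upd_apply lessThan_Suc)
  qed
qed (use n in \<open>auto simp: upd_apply runmin_empty\<close>)

lemma wlp_scan:
  assumes n: "nmem s ''n'' 0 0 = n"
  shows "wlp scan_prog s (\<lambda>s'. runmin
    (\<lambda>(a, b). nmem s ''seen'' a 0 \<noteq> 0 \<and> nmem s ''seen'' b 0 = 0 \<and> nmem s ''adj'' a b \<noteq> 0)
    (\<lambda>(a, b). rmem s ''dist'' a 0 + rmem s ''w'' a b) ({..<n} \<times> {..<n})
    (nmem s' ''fnd'' 0 0) (rmem s' ''best'' 0 0) (nmem s' ''p'' 0 0, nmem s' ''q'' 0 0))"
    (is "wlp _ _ (\<lambda>s'. runmin ?C ?val _ _ _ _)")
proof -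
  define Inv where "Inv J s' \<longleftrightarrow> runmin ?C ?val J
    (nmem s' ''fnd'' 0 0) (rmem s' ''best'' 0 0) (nmem s' ''p'' 0 0, nmem s' ''q'' 0 0)" for J and s' :: state
  have "wlp scan_prog s (Inv ({..<n} \<times> {..<n}))"
    unfolding scan_prog_def wlp_Seq wlp_NAssign
  proof (rule wlp_For[where N = n and I = "\<lambda>k. Inv ({..<k} \<times> {..<n})"], goal_cases)
    case (6 k s')
    note k = 6
    note fr = frame_nmem[OF 6(5)] and frr = frame_rmem[OF 6(5)]
    have eq: "nmem s' ''seen'' = nmem s ''seen''" "nmem s' ''adj'' = nmem s ''adj''"
      "rmem s' ''dist'' = rmem s ''dist''" "rmem s' ''w'' = rmem s ''w''"
      using fr[of "''seen''"] fr[of "''adj''"] frr[of "''dist''"] frr[of "''w''"] by simp_all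
    have J: "{..<Suc k} \<times> {..<n} = {..<k} \<times> {..<n} \<union> {k} \<times> {..<n}" by auto
    show ?case
    proof (rule wlp_For[where N = n and I = "\<lambda>l. Inv ({..<k} \<times> {..<n} \<union> {k} \<times> {..<l})"], goal_cases)
      case (6 l r)
      note fr = frame_nmem[OF 6(5)] and frr = frame_rmem[OF 6(5)]
      have eq': "nmem r ''seen'' = nmem s ''seen''" "nmem r ''adj'' = nmem s ''adj''"
        "rmem r ''dist'' = rmem s ''dist''" "rmem r ''w'' = rmem s ''w''" "nmem r ''a'' 0 0 = k"
        using fr[of "''seen''"] fr[of "''adj''"] frr[of "''dist''"] frr[of "''w''"] fr[of "''a''"] eq k(3)
        by simp_all
      have J': "{..<k} \<times> {..<n} \<union> {k} \<times> {..<Suc l} = insert (k, l) ({..<k} \<times> {..<n} \<union> {k} \<times> {..<l})"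
        by auto
      note inv = 6(2)[unfolded Inv_def]
      show ?case
      proof (cases "?C (k, l) \<and> (nmem r ''fnd'' 0 0 = 0 \<or> ?val (k, l) < rmem r ''best'' 0 0)")
        case True
        then show ?thesis
          unfolding J' Inv_def using runmin_take[OF inv, of "(k, l)"] 6(3) eq'
          by (auto simp: upd_apply)
      next
        case False
        then show ?thesis
          unfolding J' Inv_def using runmin_skip[OF inv, of "(k, l)"] 6(3) eq'
          by (auto simp: upd_apply)
      qed
    next
      case (7 r)
      then show ?case unfolding J by (simp add: Inv_def upd_apply)
    qed (use k in \<open>auto simp: Inv_def upd_apply\<close>)
  qed (use n in \<open>auto simp: Inv_def upd_apply runmin_empty\<close>)
  then show ?thesis unfolding Inv_def .
qed

section \<open>Correctness of Dijkstra's algorithm\<close>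

context steiner_graph
begin

definition tree_path :: "(nat \<Rightarrow> nat) \<Rightarrow> (nat \<Rightarrow> nat \<Rightarrow> nat) \<Rightarrow> nat \<Rightarrow> nat set set" where
  "tree_path par anc v = {{u, par u} | u. u < n \<and> anc v u \<noteq> 0}"

text \<open>The invariant of Dijkstra's algorithm with root set \<open>R\<close>: the stored tree
  path bounds the distance of \<open>v\<close> from above, and every connecting edge set bounds it
  from below. By the last clause, paths of settled vertices are unaffected by writes at unsettled
  ones.\<close>

definition settled ::
    "nat set \<Rightarrow> nat set \<Rightarrow> (nat \<Rightarrow> real) \<Rightarrow> (nat \<Rightarrow> nat) \<Rightarrow> (nat \<Rightarrow> nat \<Rightarrow> nat) \<Rightarrow> bool" where
  "settled R S d par anc \<longleftrightarrow> R \<subseteq> S \<and> S \<subseteq> {..<n} \<and> (\<forall>v\<in>S.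
     tree_path par anc v \<subseteq> E \<and> sum w (tree_path par anc v) \<le> d v \<and>
     (\<exists>a\<in>R. (a, v) \<in> conn (tree_path par anc v)) \<and>
     (\<forall>a\<in>R. \<forall>F\<subseteq>E. (a, v) \<in> conn F \<longrightarrow> d v \<le> sum w F) \<and>
     (\<forall>u<n. anc v u \<noteq> 0 \<longrightarrow> u \<in> S))"

lemma settled_start:
  assumes "R \<subseteq> {..<n}" "\<And>v. v \<in> R \<Longrightarrow> d v = 0" "\<And>v u. v \<in> R \<Longrightarrow> u < n \<Longrightarrow> anc v u = 0"
  shows "settled R R d par anc"
proof -
  have "tree_path par anc v = {}" if "v \<in> R" for v
    using assms that unfolding tree_path_def by auto
  then show ?thesis unfolding settled_def using assms w_sum_nonneg by (auto simp: conn_empty)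
qed

text \<open>The usual argument for the lower bound: whatever connects a root to \<open>b\<close>
  leaves \<open>S\<close> through some edge \<open>{p, q}\<close>, and the part inside
  \<open>S\<close> already costs at least \<open>d p\<close>.\<close>

lemma settled_step:
  assumes S: "settled R S d par anc" and ab: "a \<in> S" "b \<notin> S" "{a, b} \<in> E"
    and m: "m = d a + w {a, b}"
    and least: "\<And>p q. p \<in> S \<Longrightarrow> q \<notin> S \<Longrightarrow> {p, q} \<in> E \<Longrightarrow> m \<le> d p + w {p, q}"
    and d': "d' b = m" "\<And>v. v \<in> S \<Longrightarrow> d' v = d v"
    and par': "par' b = a" "\<And>v. v \<in> S \<Longrightarrow> par' v = par v"
    and anc': "\<And>u. u < n \<Longrightarrow> anc' b u = (if u = b then 1 else anc a u)"
      "\<And>v u. v \<in> S \<Longrightarrow> u < n \<Longrightarrow> anc' v u = anc v u"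
  shows "settled R (insert b S) d' par' anc'"
proof -
  let ?P = "tree_path par anc" and ?P' = "tree_path par' anc'"
  have bn: "b < n" using edgeD ab by blast
  have sub: "u \<in> S" if "v \<in> S" "u < n" "anc v u \<noteq> 0" for u v
    using S that unfolding settled_def by blast
  have old: "?P' v = ?P v" if "v \<in> S" for v
    using that anc' par' sub unfolding tree_path_def by (intro Collect_cong) (metis (full_types))
  have new: "?P' b = insert {a, b} (?P a)"
  proof -
    have "?P' b = {{b, par' b}} \<union> {{u, par' u} | u. u < n \<and> u \<noteq> b \<and> anc a u \<noteq> 0}"
    proof -
      have "anc' b u \<noteq> 0 \<longleftrightarrow> u = b \<or> anc a u \<noteq> 0" if "u < n" for u
        using anc'(1)[OF that] by simp
      with bn show ?thesis unfolding tree_path_def by blast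
    qed
    also have "{{u, par' u} | u. u < n \<and> u \<noteq> b \<and> anc a u \<noteq> 0} = ?P a"
      unfolding tree_path_def using sub[OF ab(1)] ab(2) par'(2) by (intro Collect_cong) (metis (full_types))
    finally show ?thesis using par' by (simp add: insert_commute)
  qed
  have aS: "?P a \<subseteq> E" "sum w (?P a) \<le> d a" "\<exists>r\<in>R. (r, a) \<in> conn (?P a)"
    using S ab unfolding settled_def by auto
  have "?P' b \<subseteq> E" using new aS ab by auto
  moreover have "sum w (?P' b) \<le> d' b"
  proof -
    have "sum w (?P' b) = sum w ({{a, b}} \<union> ?P a)" using new by simp
    also have "\<dots> \<le> w {a, b} + sum w (?P a)" using w_Un[of "{{a, b}}" "?P a"] aS ab by simp
    finally show ?thesis using aS d' m by linarith
  qed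
  moreover have "\<exists>r\<in>R. (r, b) \<in> conn (?P' b)"
  proof -
    obtain r where "r \<in> R" "(r, a) \<in> conn (?P a)" using aS by blast
    then have "(r, a) \<in> conn (?P' b)" using new by (auto intro: conn_mono)
    moreover have "(a, b) \<in> conn (?P' b)" using new by (auto intro: conn_edge)
    ultimately show ?thesis by (intro bexI[OF _ \<open>r \<in> R\<close>]) (rule conn_trans)
  qed
  moreover have "d' b \<le> sum w F" if r: "r \<in> R" and F: "F \<subseteq> E" "(r, b) \<in> conn F" for r F
  proof -
    have "r \<in> S" using r S unfolding settled_def by auto
    obtain p q where pq: "p \<in> S" "q \<notin> S" "{p, q} \<in> F" "(r, p) \<in> conn {e \<in> F. e \<subseteq> S}"
      by (rule conn_exit[OF F(2) \<open>r \<in> S\<close> ab(2)])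
    let ?F = "{e \<in> F. e \<subseteq> S}"
    have "\<forall>a\<in>R. \<forall>F\<subseteq>E. (a, p) \<in> conn F \<longrightarrow> d p \<le> sum w F"
      using S pq(1) unfolding settled_def by simp
    moreover have "?F \<subseteq> E" using F by auto
    ultimately have "d p \<le> sum w ?F" using r pq(4) by simp
    \<comment> \<open>The edge leaves \<open>S\<close>, so it is not counted among the edges inside
      \<open>S\<close>.\<close>
    moreover have "sum w ({{p, q}} \<union> ?F) = w {p, q} + sum w ?F"
    proof -
      have "finite ?F" using F finite_E finite_subset by fastforce
      then show ?thesis using pq by simp
    qed
    moreover have "sum w ({{p, q}} \<union> ?F) \<le> sum w F" by (rule w_mono) (use F pq in auto)
    moreover have "m \<le> d p + w {p, q}" using least pq F by blast
    ultimately show ?thesis using d' by linarith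
  qed
  moreover have "\<forall>u<n. anc' b u \<noteq> 0 \<longrightarrow> u \<in> insert b S" using anc' sub[OF ab(1)] by auto
  ultimately show ?thesis
    using S old d'(2) anc'(2) bn unfolding settled_def by auto
qed

definition holds_graph :: "nat set \<Rightarrow> state \<Rightarrow> bool" where
  "holds_graph P s \<longleftrightarrow> nmem s ''n'' 0 0 = n \<and>
     (\<forall>i j. nmem s ''adj'' i j \<noteq> 0 \<longleftrightarrow> {i, j} \<in> E) \<and>
     (\<forall>i j. {i, j} \<in> E \<longrightarrow> rmem s ''w'' i j = w {i, j}) \<and>
     (\<forall>i<n. nmem s ''pred'' i 0 \<noteq> 0 \<longleftrightarrow> i \<in> P)"

lemma holds_graph_frame:
  "holds_graph P s \<Longrightarrow> frame c s s' \<Longrightarrow> nw c \<inter> {''n'', ''adj'', ''pred''} = {} \<Longrightarrow> ''w'' \<notin> rw c \<Longrightarrow>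
    holds_graph P s'"
  unfolding holds_graph_def frame_def by auto

definition seen_set :: "state \<Rightarrow> nat set" where
  "seen_set s = {v. v < n \<and> nmem s ''seen'' v 0 \<noteq> 0}"

abbreviation settled_state :: "nat set \<Rightarrow> state \<Rightarrow> bool" where
  "settled_state R s \<equiv> settled R (seen_set s) (\<lambda>v. rmem s ''dist'' v 0) (\<lambda>v. nmem s ''par'' v 0) (nmem s ''anc'')"

definition closed_set :: "nat set \<Rightarrow> bool" where
  "closed_set S \<longleftrightarrow> (\<forall>a\<in>S. \<forall>b. {a, b} \<in> E \<longrightarrow> b \<in> S)"

text \<open>As long as an edge leaves the seen set, each round adds a vertex. After \<open>n\<close>
  rounds either the set is closed or it consists of all vertices and is closed as well.\<close>

lemma wlp_settle:
  assumes g: "holds_graph P s" and s: "settled_state R s"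
  shows "wlp settle_prog s (\<lambda>s'. settled_state R s' \<and> closed_set (seen_set s'))"
proof -
  have n: "nmem s ''n'' 0 0 = n" using g unfolding holds_graph_def by auto
  have row: "wlp (For ''u'' (NAssign ''anc'' (var ''q'') (var ''u'') (Cell ''anc'' (var ''p'') (var ''u'')))) r
      (\<lambda>r'. \<forall>v u. nmem r' ''anc'' v u = (if v = nmem r ''q'' 0 0 \<and> u < n then nmem r ''anc'' (nmem r ''p'' 0 0) u else nmem r ''anc'' v u))"
    if "nmem r ''p'' 0 0 \<noteq> nmem r ''q'' 0 0" "nmem r ''n'' 0 0 = n" for r
  proof (rule wlp_For[where N = n and I = "\<lambda>l r'. \<forall>v u. nmem r' ''anc'' v u =
      (if v = nmem r ''q'' 0 0 \<and> u < l then nmem r ''anc'' (nmem r ''p'' 0 0) u else nmem r ''anc'' v u)"], goal_cases)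
    case (6 k s')
    have "nmem s' ''q'' = nmem r ''q''" "nmem s' ''p'' = nmem r ''p''"
      using frame_nmem[OF 6(5), of "''q''"] frame_nmem[OF 6(5), of "''p''"] by simp_all
    then show ?case using 6(2,3) that by (auto simp: upd_apply less_Suc_eq)
  qed (use that in \<open>auto simp: upd_apply\<close>)
  have nws: "nw scan_prog = {''fnd'', ''a'', ''b'', ''p'', ''q''}" "rw scan_prog = {''best''}"
    by (auto simp: scan_prog_def)
  show ?thesis
    unfolding settle_prog_def
  proof (rule wlp_For[where N = n and I = "\<lambda>k s'. settled_state R s' \<and>
      (k \<le> card (seen_set s') \<or> closed_set (seen_set s'))"], goal_cases)
    case (6 k s')
    let ?S = "seen_set s'"
    have g': "holds_graph P s'" by (rule holds_graph_frame[OF g 6(5)]) (auto simp: nws)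
    have st: "settled_state R s'" using 6(2) by blast
    have upds: "seen_set (r\<lparr>nmem := upd (nmem r) ''k'' 0 0 c\<rparr>) = seen_set r" for r c
      unfolding seen_set_def by simp
    show ?case
      unfolding wlp_Seq
    proof (rule wlp_cons[OF wlp_scan[OF 6(4)]])
      fix r assume rm: "runmin
          (\<lambda>(a, b). nmem s' ''seen'' a 0 \<noteq> 0 \<and> nmem s' ''seen'' b 0 = 0 \<and> nmem s' ''adj'' a b \<noteq> 0)
          (\<lambda>(a, b). rmem s' ''dist'' a 0 + rmem s' ''w'' a b) ({..<n} \<times> {..<n})
          (nmem r ''fnd'' 0 0) (rmem r ''best'' 0 0) (nmem r ''p'' 0 0, nmem r ''q'' 0 0)"
        and fr: "frame scan_prog s' r"
      have eq: "nmem r a = nmem s' a" if "a \<in> {''seen'', ''anc'', ''par'', ''n'', ''adj''}" for a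
        using frame_nmem[OF fr, of a] that by (auto simp: nws)
      have eqr: "rmem r ''dist'' = rmem s' ''dist''"
        using frame_rmem[OF fr, of "''dist''"] by (auto simp: nws)
      have seen_r: "seen_set r = ?S" unfolding seen_set_def using eq by simp
      have st_r: "settled_state R r" using st eq eqr seen_r by simp
      let ?p = "nmem r ''p'' 0 0" and ?q = "nmem r ''q'' 0 0" and ?m = "rmem r ''best'' 0 0"
      show "wlp (If (nz (var ''fnd''))
     (Seq (For ''u'' (NAssign ''anc'' (var ''q'') (var ''u'') (Cell ''anc'' (var ''p'') (var ''u''))))
       (Seq (NAssign ''anc'' (var ''q'') (var ''q'') (Num 1))
         (Seq (raset ''dist'' (var ''q'') (rvar ''best''))
           (Seq (aset ''par'' (var ''q'') (var ''p''))
             (aset ''seen'' (var ''q'') (Num 1))))))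
     Skip) r (\<lambda>s''. settled_state R (s''\<lparr>nmem := upd (nmem s'') ''k'' 0 0 (Suc k)\<rparr>) \<and>
        (Suc k \<le> card (seen_set (s''\<lparr>nmem := upd (nmem s'') ''k'' 0 0 (Suc k)\<rparr>)) \<or>
         closed_set (seen_set (s''\<lparr>nmem := upd (nmem s'') ''k'' 0 0 (Suc k)\<rparr>))))"
      proof (cases "nmem r ''fnd'' 0 0 = 0")
        case True
        have "closed_set ?S"
          unfolding closed_set_def
        proof (intro ballI allI impI)
          fix a b assume ab: "a \<in> ?S" "{a, b} \<in> E"
          then have "a < n" "b < n" using edgeD by auto
          moreover have "nmem s' ''adj'' a b \<noteq> 0" using g' ab unfolding holds_graph_def by blast
          moreover have "\<forall>j\<in>{..<n} \<times> {..<n}. \<not> (case j of (a, b) \<Rightarrow>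
              nmem s' ''seen'' a 0 \<noteq> 0 \<and> nmem s' ''seen'' b 0 = 0 \<and> nmem s' ''adj'' a b \<noteq> 0)"
            using rm True unfolding runmin_def by simp
          ultimately show "b \<in> ?S" using ab unfolding seen_set_def by blast
        qed
        then show ?thesis using True st_r seen_r by (simp add: upds)
      next
        case False
        then have pq: "nmem s' ''seen'' ?p 0 \<noteq> 0" "nmem s' ''seen'' ?q 0 = 0" "nmem s' ''adj'' ?p ?q \<noteq> 0"
          "?m = rmem s' ''dist'' ?p 0 + rmem s' ''w'' ?p ?q"
          and least: "\<And>a b. a < n \<Longrightarrow> b < n \<Longrightarrow> nmem s' ''seen'' a 0 \<noteq> 0 \<Longrightarrow> nmem s' ''seen'' b 0 = 0 \<Longrightarrow>
            nmem s' ''adj'' a b \<noteq> 0 \<Longrightarrow> ?m \<le> rmem s' ''dist'' a 0 + rmem s' ''w'' a b"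
          using rm unfolding runmin_def by auto
        have e: "{?p, ?q} \<in> E" using pq g' unfolding holds_graph_def by blast
        then have lt: "?p < n" "?q < n" "?p \<noteq> ?q" using edgeD by auto
        have copy: "wlp (For ''u'' (NAssign ''anc'' (var ''q'') (var ''u'') (Cell ''anc'' (var ''p'') (var ''u'')))) r
          (\<lambda>r'. settled R (insert ?q ?S) ((\<lambda>v. rmem r ''dist'' v 0)(?q := ?m)) ((\<lambda>v. nmem r ''par'' v 0)(?q := ?p))
             (\<lambda>v u. if v = ?q \<and> u = ?q then 1 else nmem r' ''anc'' v u))"
        proof (rule wlp_cons[OF row[OF lt(3)]])
          show "nmem r ''n'' 0 0 = n" using eq 6(4) by simp
        next
          fix r'
          assume anc: "\<forall>v u. nmem r' ''anc'' v u = (if v = ?q \<and> u < n then nmem r ''anc'' ?p u else nmem r ''anc'' v u)"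
          show "settled R (insert ?q ?S) ((\<lambda>v. rmem r ''dist'' v 0)(?q := ?m)) ((\<lambda>v. nmem r ''par'' v 0)(?q := ?p))
             (\<lambda>v u. if v = ?q \<and> u = ?q then 1 else nmem r' ''anc'' v u)"
          proof (rule settled_step[OF st _ _ e])
            show "?p \<in> ?S" "?q \<notin> ?S" using pq lt unfolding seen_set_def by auto
            show "?m = rmem s' ''dist'' ?p 0 + w {?p, ?q}"
              using pq e g' unfolding holds_graph_def by simp
            fix a b assume ab: "a \<in> ?S" "b \<notin> ?S" "{a, b} \<in> E"
            then show "?m \<le> rmem s' ''dist'' a 0 + w {a, b}"
              using least[of a b] edgeD[OF ab(3)] g' unfolding holds_graph_def seen_set_def by auto
          next
            have q: "v \<noteq> ?q" if "v \<in> ?S" for v using pq that unfolding seen_set_def by auto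
            note eqs = eqr eq[of "''par''", simplified] eq[of "''anc''", simplified]
            fix v assume v: "v \<in> ?S"
            show "((\<lambda>v. rmem r ''dist'' v 0)(?q := ?m)) v = rmem s' ''dist'' v 0"
              "((\<lambda>v. nmem r ''par'' v 0)(?q := ?p)) v = nmem s' ''par'' v 0"
              using q[OF v] eqs by simp_all
            fix u assume "u < n"
            show "(if v = ?q \<and> u = ?q then 1 else nmem r' ''anc'' v u) = nmem s' ''anc'' v u"
              using q[OF v] anc eqs by simp
          next
            fix u assume "u < n"
            then show "(if ?q = ?q \<and> u = ?q then 1 else nmem r' ''anc'' ?q u) = (if u = ?q then 1 else nmem s' ''anc'' ?p u)"
              using anc eq[of "''anc''", simplified] by simp
          qed simp_all
        qed
        have bv: "bval (nz (var ''fnd'')) r" using False by simp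
        show ?thesis
          unfolding wlp_If wlp_Seq if_P[OF bv]
        proof (rule wlp_cons[OF copy], goal_cases)
          case (1 r')
          note stl = 1(1) and fr' = 1(2)
          have eq': "nmem r' ''q'' = nmem r ''q''" "nmem r' ''p'' = nmem r ''p''" "nmem r' ''seen'' = nmem r ''seen''"
             "nmem r' ''par'' = nmem r ''par''" "rmem r' = rmem r"
            using frame_nmem[OF fr', of "''q''"] frame_nmem[OF fr', of "''p''"] frame_nmem[OF fr', of "''seen''"]
             frame_nmem[OF fr', of "''par''"] frame_rmem[OF fr'] by (simp_all add: fun_eq_iff)
          let ?r = "r'\<lparr>rmem := upd (rmem r') ''dist'' ?q 0 ?m, nmem := upd (upd (upd (upd (nmem r')
             ''anc'' ?q ?q (Suc 0)) ''par'' ?q 0 ?p) ''seen'' ?q 0 (Suc 0)) ''k'' 0 0 (Suc k)\<rparr>"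
          have 1: "seen_set ?r = insert ?q ?S"
            using lt seen_r unfolding seen_set_def by (auto simp: upd_apply eq')
          have 2: "(\<lambda>v. rmem ?r ''dist'' v 0) = (\<lambda>v. rmem r ''dist'' v 0)(?q := ?m)"
            by (auto simp: upd_apply eq')
          have 3: "(\<lambda>v. nmem ?r ''par'' v 0) = (\<lambda>v. nmem r ''par'' v 0)(?q := ?p)"
            by (auto simp: upd_apply eq')
          have 4: "nmem ?r ''anc'' = (\<lambda>v u. if v = ?q \<and> u = ?q then 1 else nmem r' ''anc'' v u)"
            by (auto simp: upd_apply fun_eq_iff)
          have "settled_state R ?r" using stl unfolding 1 2 3 4 .
          moreover have "Suc k \<le> card (seen_set ?r) \<or> closed_set ?S"
          proof -
            have "?q \<notin> ?S" "finite ?S" using pq unfolding seen_set_def by auto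
            then show ?thesis using 6(2) unfolding 1 by auto
          qed
          \<comment> \<open>The edge found by the scan leaves \<open>?S\<close>, which rules out the
            second alternative of the invariant.\<close>
          moreover have "\<not> closed_set ?S"
            using e pq lt unfolding closed_set_def seen_set_def by blast
          ultimately have "settled_state R ?r \<and> (Suc k \<le> card (seen_set ?r) \<or> closed_set (seen_set ?r))"
            by blast
          then show ?case by (simp add: eq')
        qed
      qed
    qed
  next
    case (7 s')
    have "closed_set (seen_set s')" if "n \<le> card (seen_set s')"
    proof -
      have "seen_set s' \<subseteq> {..<n}" unfolding seen_set_def by auto
      with that have "seen_set s' = {..<n}" by (metis card_lessThan card_seteq finite_lessThan)
      then show ?thesis using edgeD unfolding closed_set_def by auto
    qed
    then show ?case using 7 by blast
  qed (use n s in \<open>auto simp: seen_set_def nws\<close>)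
qed

end

section \<open>Correctness of the algorithm\<close>

context steiner_graph
begin

definition path_of :: "state \<Rightarrow> nat set set" where
  "path_of s = tree_path (\<lambda>v. nmem s ''par'' v 0) (nmem s ''anc'') (nmem s ''q'' 0 0)"

text \<open>A shortest connection from \<open>R\<close> to \<open>T\<close>: the recorded path gives
  the upper bound, the last clause the lower bound. No result means that no connection
  exists.\<close>

definition search_result :: "nat set \<Rightarrow> nat set \<Rightarrow> state \<Rightarrow> bool" where
  "search_result R T s \<longleftrightarrow>
     (if nmem s ''fnd'' 0 0 = 0 then \<forall>a\<in>R. \<forall>b\<in>T. \<forall>F\<subseteq>E. (a, b) \<notin> conn F
      else nmem s ''q'' 0 0 \<in> T \<and> path_of s \<subseteq> E \<and> sum w (path_of s) \<le> rmem s ''best'' 0 0 \<and>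
        (\<exists>a\<in>R. (a, nmem s ''q'' 0 0) \<in> conn (path_of s)) \<and>
        (\<forall>a\<in>R. \<forall>b\<in>T. \<forall>F\<subseteq>E. (a, b) \<in> conn F \<longrightarrow> rmem s ''best'' 0 0 \<le> sum w F))"

lemma wlp_search:
  assumes g: "holds_graph P s" and T: "T \<subseteq> {..<n}"
    and tb: "\<And>s' v. v < n \<Longrightarrow> nmem s' ''v'' 0 0 = v \<Longrightarrow>
      (\<And>a. a \<notin> nw (search_prog tb) \<Longrightarrow> nmem s' a = nmem s a) \<Longrightarrow> bval tb s' \<longleftrightarrow> v \<in> T"
    and R: "R = {v. v < n \<and> nmem s ''cls'' v 0 = nmem s ''cls'' (nmem s ''req'' 0 0) 0}"
  shows "wlp (search_prog tb) s (search_result R T)"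
  unfolding search_prog_def wlp_Seq
proof (rule wlp_cons[OF wlp_init[where n = n]], goal_cases)
  case 1
  then show ?case using g unfolding holds_graph_def by blast
next
  case (2 s1)
  have nwi: "nw init_prog = {''v'', ''seen'', ''u'', ''anc''}" "rw init_prog = {''dist''}"
    by (auto simp: init_prog_def)
  have seen1: "seen_set s1 = R"
    unfolding seen_set_def R using 2(1) by (auto split: if_splits)
  have st1: "settled_state R s1"
    unfolding seen1 by (rule settled_start) (use 2(1) in \<open>auto simp: R\<close>)
  have g1: "holds_graph P s1" by (rule holds_graph_frame[OF g 2(2)]) (auto simp: nwi)
  show ?case
  proof (rule wlp_cons[OF wlp_settle[OF g1 st1]], goal_cases)
    case (1 s2)
    note st = conjunct1[OF 1(1)] conjunct2[OF 1(1)]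
    have nws: "nw settle_prog = {''k'', ''fnd'', ''a'', ''b'', ''p'', ''q'', ''u'', ''anc'', ''par'', ''seen''}"
      by (auto simp: settle_prog_def scan_prog_def)
    have g2: "holds_graph P s2"
      by (rule holds_graph_frame[OF g1 1(2)]) (auto simp: nws settle_prog_def scan_prog_def)
    have eq: "nmem s2 a = nmem s a" if "a \<notin> nw (search_prog tb)" for a
      using frame_nmem[OF 2(2), of a] frame_nmem[OF 1(2), of a] that by (auto simp: nwi nws nw_search)
    show ?case
    proof (rule wlp_cons[OF wlp_nearest[where T = T and n = n]], goal_cases)
      case 1
      then show ?case using g2 unfolding holds_graph_def by blast
    next
      case (2 s' v)
      then show ?case using eq by (intro tb) (auto simp: nw_search)
    next
      case (3 s3)
      have nwn: "nw (nearest_prog tb) = {''fnd'', ''v'', ''q''}" "rw (nearest_prog tb) = {''best''}"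
        by (auto simp: nearest_prog_def)
      let ?q = "nmem s3 ''q'' 0 0" and ?m = "rmem s3 ''best'' 0 0"
      have RS: "R \<subseteq> seen_set s2" using st unfolding settled_def by blast
      \<comment> \<open>Everything reachable from \<open>R\<close> has been seen, because a walk
        cannot leave a closed set.\<close>
      have reach: "b \<in> seen_set s2" if aR: "a \<in> R" and F: "F \<subseteq> E" and ab: "(a, b) \<in> conn F" for a b F
      proof (rule ccontr)
        assume b: "b \<notin> seen_set s2"
        have a: "a \<in> seen_set s2" using RS aR by blast
        obtain p r where "p \<in> seen_set s2" "r \<notin> seen_set s2" "{p, r} \<in> F"
          by (rule conn_exit[OF ab a b])
        then show False using st(2) F unfolding closed_set_def by blast
      qed
      have path: "path_of s3 = tree_path (\<lambda>v. nmem s2 ''par'' v 0) (nmem s2 ''anc'') ?q"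
        unfolding path_of_def using frame_nmem[OF 3(2), of "''par''"] frame_nmem[OF 3(2), of "''anc''"]
        by (simp add: nwn)
      show ?case
      proof (cases "nmem s3 ''fnd'' 0 0 = 0")
        case True
        then have none: "\<forall>v<n. \<not> (v \<in> T \<and> nmem s2 ''seen'' v 0 \<noteq> 0)"
          using 3(1) unfolding runmin_def by simp
        have "\<not> (a, b) \<in> conn F" if "a \<in> R" "b \<in> T" "F \<subseteq> E" for a b F
          using reach[OF that(1,3), of b] none that(2) unfolding seen_set_def by blast
        then show ?thesis using True unfolding search_result_def by simp
      next
        case False
        then have q: "?q \<in> T" "nmem s2 ''seen'' ?q 0 \<noteq> 0" "?m = rmem s2 ''dist'' ?q 0"
          and least: "\<And>v. v < n \<Longrightarrow> v \<in> T \<Longrightarrow> nmem s2 ''seen'' v 0 \<noteq> 0 \<Longrightarrow> ?m \<le> rmem s2 ''dist'' v 0"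
          using 3(1) unfolding runmin_def by auto
        have qS: "?q \<in> seen_set s2" using q T unfolding seen_set_def by auto
        have "?m \<le> sum w F" if "a \<in> R" "b \<in> T" "F \<subseteq> E" "(a, b) \<in> conn F" for a b F
        proof -
          have b: "b \<in> seen_set s2" using reach that by blast
          have "rmem s2 ''dist'' b 0 \<le> sum w F" using st(1) b that unfolding settled_def by simp
          moreover have "?m \<le> rmem s2 ''dist'' b 0" using least b that unfolding seen_set_def by blast
          ultimately show ?thesis by linarith
        qed
        then show ?thesis
          using False q st(1) qS unfolding search_result_def path settled_def by simp
      qed
    qed
  qed
qed

lemma wlp_buy_path:
  assumes "holds_graph P s"
  shows "wlp buy_prog s (\<lambda>s'. purchase s' = purchase s \<union> path_of s)"
  using wlp_buy[of s n] assms unfolding holds_graph_def path_of_def tree_path_def by blast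

text \<open>
  Everything but the balance of the costs, with \<open>\<beta>\<close> the amount that may still be spent. The last two
  conditions say that \<open>g x\<close> is at most the distance to any terminal that came before \<open>x\<close>, in a form
  that does not mention the order of arrival.
\<close>

definition core :: "nat set \<Rightarrow> nat set \<Rightarrow> (nat \<Rightarrow> nat) \<Rightarrow> nat set set \<Rightarrow> (nat \<Rightarrow> real) \<Rightarrow> real \<Rightarrow> bool" where
  "core P A cls B g \<beta> \<longleftrightarrow> A \<subseteq> {..<n} \<and> B \<subseteq> E \<and>
     (\<forall>u<n. \<forall>v<n. cls u = cls v \<longrightarrow> (u, v) \<in> conn B \<and> (u = v \<or> u \<in> P \<and> v \<in> P)) \<and>
     (\<forall>u\<in>A. \<forall>v\<in>A. (u, v) \<in> conn B) \<and> sum w B + \<beta> \<le> 2 * sum g A \<and>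
     (\<forall>x\<in>A. 0 \<le> g x \<and> (\<forall>F\<subseteq>E. connects F A \<longrightarrow> g x \<le> sum w F)) \<and>
     (\<forall>x\<in>A. \<forall>y\<in>A. \<forall>F\<subseteq>E. x \<noteq> y \<longrightarrow> (x, y) \<in> conn F \<longrightarrow> min (g x) (g y) \<le> sum w F)"

section \<open>Connectivity, cost and separation when a terminal arrives and when classes
  merge\<close>

lemma core_classD:
  "core P A cls B g \<beta> \<Longrightarrow> u < n \<Longrightarrow> v < n \<Longrightarrow> cls u = cls v \<Longrightarrow>
    (u, v) \<in> conn B \<and> (u = v \<or> u \<in> P \<and> v \<in> P)"
  unfolding core_def by simp

text \<open>The new terminal reaches the start of \<open>p\<close> inside its class, then an earlier
  terminal along \<open>p\<close>, then all others through \<open>B\<close>. As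
  \<open>\<gamma>\<close> is at most the distance to every earlier terminal, separation
  survives.\<close>

lemma core_arrive:
  assumes c: "core P A cls B g 0" and x: "x < n" "x \<notin> A" and \<gamma>: "0 \<le> \<gamma>" "A = {} \<Longrightarrow> \<gamma> = 0"
    and p: "p \<subseteq> E" "sum w p \<le> \<gamma>" "A \<noteq> {} \<Longrightarrow> \<exists>a<n. \<exists>b\<in>A. cls a = cls x \<and> (a, b) \<in> conn p"
    and least: "\<And>b F. b \<in> A \<Longrightarrow> F \<subseteq> E \<Longrightarrow> (x, b) \<in> conn F \<Longrightarrow> \<gamma> \<le> sum w F"
  shows "core P (insert x A) cls (B \<union> p) (g(x := \<gamma>)) \<gamma>"
proof -
  have A: "A \<subseteq> {..<n}" "B \<subseteq> E" "finite A" using c finite_subset unfolding core_def by auto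
  have mono: "(u, v) \<in> conn (B \<union> p)" if "(u, v) \<in> conn B" for u v
    using conn_mono[OF that, of "B \<union> p"] by blast
  have xA: "(x, u) \<in> conn (B \<union> p)" if "u \<in> A" for u
  proof -
    obtain a b where ab: "a < n" "b \<in> A" "cls a = cls x" "(a, b) \<in> conn p" using p(3) \<open>u \<in> A\<close> by blast
    have "(x, a) \<in> conn B" "(b, u) \<in> conn B" using c ab x that unfolding core_def by auto
    then have "(x, a) \<in> conn (B \<union> p)" "(a, b) \<in> conn (B \<union> p)" "(b, u) \<in> conn (B \<union> p)"
      using mono conn_mono[OF ab(4), of "B \<union> p"] by auto
    then show ?thesis by (meson conn_trans)
  qed
  have 1: "\<forall>u\<in>insert x A. \<forall>v\<in>insert x A. (u, v) \<in> conn (B \<union> p)"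
    using xA conn_sym[OF xA] mono c unfolding core_def by auto
  have g: "(g(x := \<gamma>)) y = g y" if "y \<in> A" for y using that x by auto
  have "sum (g(x := \<gamma>)) A = sum g A" by (rule sum.cong) (use g in auto)
  then have "sum (g(x := \<gamma>)) (insert x A) = \<gamma> + sum g A" using A x by simp
  moreover have "sum w (B \<union> p) \<le> sum w B + sum w p" using w_Un A p by blast
  \<comment> \<open>The new cost enters the right-hand side twice: once for the path, once as the
    budget for growth.\<close>
  ultimately have 2: "sum w (B \<union> p) + \<gamma> \<le> 2 * sum (g(x := \<gamma>)) (insert x A)"
    using p c unfolding core_def by simp
  have 3: "\<forall>y\<in>insert x A. 0 \<le> (g(x := \<gamma>)) y \<and>
    (\<forall>F\<subseteq>E. connects F (insert x A) \<longrightarrow> (g(x := \<gamma>)) y \<le> sum w F)"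
  proof (intro ballI conjI allI impI)
    fix y assume y: "y \<in> insert x A"
    show "0 \<le> (g(x := \<gamma>)) y" using y \<gamma> c unfolding core_def by auto
    fix F assume F: "F \<subseteq> E" "connects F (insert x A)"
    show "(g(x := \<gamma>)) y \<le> sum w F"
    proof (cases "y = x")
      case True
      show ?thesis
      proof (cases "A = {}")
        case True
        then show ?thesis using \<open>y = x\<close> \<gamma> w_sum_nonneg F by simp
      next
        case False
        then obtain b where "b \<in> A" by blast
        then show ?thesis using least[of b F] F \<open>y = x\<close> unfolding connects_conn by simp
      qed
    next
      case False
      moreover have "connects F A" using F unfolding connects_conn by blast
      ultimately show ?thesis using y F c unfolding core_def by simp
    qed
  qed
  have 4: "\<forall>y\<in>insert x A. \<forall>z\<in>insert x A. \<forall>F\<subseteq>E. y \<noteq> z \<longrightarrow> (y, z) \<in> conn F \<longrightarrow>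
      min ((g(x := \<gamma>)) y) ((g(x := \<gamma>)) z) \<le> sum w F"
  proof (intro ballI allI impI)
    fix y z F assume yz: "y \<in> insert x A" "z \<in> insert x A" "F \<subseteq> E" "y \<noteq> z" "(y, z) \<in> conn F"
    consider "y = x" "z \<in> A" | "z = x" "y \<in> A" | "y \<in> A" "z \<in> A" "y \<noteq> x" "z \<noteq> x" using yz by blast
    then show "min ((g(x := \<gamma>)) y) ((g(x := \<gamma>)) z) \<le> sum w F"
    proof cases
      case 1
      then show ?thesis using least[of z F] yz by simp
    next
      case 2
      then show ?thesis using least[of y F] yz conn_sym[OF yz(5)] by simp
    next
      case 3
      then show ?thesis using c yz unfolding core_def by simp
    qed
  qed
  have 5: "\<forall>u<n. \<forall>v<n. cls u = cls v \<longrightarrow> (u, v) \<in> conn (B \<union> p) \<and> (u = v \<or> u \<in> P \<and> v \<in> P)"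
    using c mono unfolding core_def by simp
  have 6: "insert x A \<subseteq> {..<n}" "B \<union> p \<subseteq> E" using A(1,2) p(1) x(1) by simp_all
  show ?thesis unfolding core_def by (intro conjI 1 2 3 4 5 6)
qed

text \<open>The path is paid from the budget. Since \<open>x\<close> and \<open>q\<close> are
  predicted, so are all members of the merged class, and the path links its two halves.\<close>

lemma core_merge:
  assumes c: "core P A cls B g \<beta>" and P: "P \<subseteq> {..<n}" "x \<in> P" "q \<in> P"
    and p: "p \<subseteq> E" "sum w p \<le> r" "a < n" "cls a = cls x" "(a, q) \<in> conn p"
    and cls': "\<And>v. v < n \<Longrightarrow> cls' v = (if cls v = cls q then cls x else cls v)"
  shows "core P A cls' (B \<union> p) g (\<beta> - r)"
proof -
  have B: "B \<subseteq> E" using c unfolding core_def by auto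
  have lt: "x < n" "q < n" using P by auto
  have mono: "(u, v) \<in> conn (B \<union> p)" if "(u, v) \<in> conn B" for u v
    using conn_mono[OF that, of "B \<union> p"] by blast
  have cl: "(u, v) \<in> conn (B \<union> p)" "u = v \<or> u \<in> P \<and> v \<in> P" if "u < n" "v < n" "cls u = cls v" for u v
    using core_classD[OF c that] mono by simp_all
  have cross: "(u, v) \<in> conn (B \<union> p)" "u \<in> P \<and> v \<in> P" if "u < n" "v < n" "cls u = cls x" "cls v = cls q" for u v
  proof -
    have "(u, a) \<in> conn (B \<union> p)" "(q, v) \<in> conn (B \<union> p)" using cl that p lt by simp_all
    moreover have "(a, q) \<in> conn (B \<union> p)" using conn_mono[OF p(5), of "B \<union> p"] by blast
    ultimately show "(u, v) \<in> conn (B \<union> p)" by (meson conn_trans)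
    show "u \<in> P \<and> v \<in> P" using cl(2)[of u x] cl(2)[of v q] that lt P by auto
  qed
  have 1: "(u, v) \<in> conn (B \<union> p) \<and> (u = v \<or> u \<in> P \<and> v \<in> P)" if uv: "u < n" "v < n" "cls' u = cls' v" for u v
  proof -
    consider "cls u = cls v" | "cls u = cls x" "cls v = cls q" | "cls v = cls x" "cls u = cls q"
      using uv cls' by (auto split: if_splits)
    then show ?thesis
    proof cases
      case 1
      then show ?thesis using cl uv by blast
    next
      case 2
      then show ?thesis using cross uv by blast
    next
      case 3
      then show ?thesis using conn_sym[OF cross(1)[of v u]] cross(2)[of v u] uv by simp
    qed
  qed
  have "sum w (B \<union> p) \<le> sum w B + sum w p" using w_Un B p by blast
  then have 2: "sum w (B \<union> p) + (\<beta> - r) \<le> 2 * sum g A" using c p unfolding core_def by linarith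
  have 3: "\<forall>u\<in>A. \<forall>v\<in>A. (u, v) \<in> conn (B \<union> p)" using c mono unfolding core_def by simp
  have 4: "A \<subseteq> {..<n}" "\<forall>x\<in>A. 0 \<le> g x \<and> (\<forall>F\<subseteq>E. connects F A \<longrightarrow> g x \<le> sum w F)"
    "\<forall>x\<in>A. \<forall>y\<in>A. \<forall>F\<subseteq>E. x \<noteq> y \<longrightarrow> (x, y) \<in> conn F \<longrightarrow> min (g x) (g y) \<le> sum w F"
    using c unfolding core_def by simp_all
  have 5: "B \<union> p \<subseteq> E" using B p(1) by simp
  have 6: "\<forall>u<n. \<forall>v<n. cls' u = cls' v \<longrightarrow> (u, v) \<in> conn (B \<union> p) \<and> (u = v \<or> u \<in> P \<and> v \<in> P)"
    by (intro allI impI 1)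
  show ?thesis unfolding core_def by (intro conjI 2 3 4 5 6)
qed

abbreviation label :: "state \<Rightarrow> nat \<Rightarrow> nat" where
  "label s \<equiv> \<lambda>v. nmem s ''cls'' v 0"

definition alg_inv :: "nat set \<Rightarrow> state \<Rightarrow> nat set \<Rightarrow> (nat \<Rightarrow> real) \<Rightarrow> bool" where
  "alg_inv P s A g \<longleftrightarrow> holds_graph P s \<and> (\<forall>v<n. nmem s ''arr'' v 0 \<noteq> 0 \<longleftrightarrow> v \<in> A) \<and>
     core P A (label s) (purchase s) g 0 \<and> balanced P (label s) A g"

text \<open>During growth \<open>x\<close> already counts as a terminal in \<open>core\<close>,
  which carries the unspent budget, but not yet in the balance.\<close>

definition growth_inv :: "nat set \<Rightarrow> state \<Rightarrow> nat set \<Rightarrow> (nat \<Rightarrow> real) \<Rightarrow> nat \<Rightarrow> real \<Rightarrow> bool" where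
  "growth_inv P s A g x \<gamma> \<longleftrightarrow> holds_graph P s \<and> nmem s ''req'' 0 0 = x \<and>
     core P (insert x A) (label s) (purchase s) (g(x := \<gamma>)) (rmem s ''bud'' 0 0) \<and>
     growing P (label s) A g x \<gamma> (rmem s ''bud'' 0 0)"

abbreviation class_of :: "state \<Rightarrow> nat \<Rightarrow> nat set" where
  "class_of s x \<equiv> {v. v < n \<and> label s v = label s x}"

lemma purchase_cong: "nmem s' ''buy'' = nmem s ''buy'' \<Longrightarrow> purchase s' = purchase s"
  by (simp add: purchase_def)

lemma nw_simps: "nw buy_prog = {''u'', ''buy''}" "rw buy_prog = {}"
  "nw relabel_prog = {''c'', ''v'', ''cls''}" "rw relabel_prog = {}"
  by (auto simp: buy_prog_def relabel_prog_def)

text \<open>A round either ends growth or strictly enlarges the class. The second alternative also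
  records that the class was unsaturated before, so that the enclosing loop can infer its size
  bound.\<close>

lemma wlp_grow:
  assumes inv: "growth_inv P s A g x \<gamma>" and P: "P \<subseteq> {..<n}" "x \<in> P"
  shows "wlp grow_prog s (\<lambda>s'. growth_inv P s' A g x \<gamma> \<and> purchase s \<subseteq> purchase s' \<and>
    (saturated P (label s') (label s' x) (rmem s' ''bud'' 0 0) \<or>
     \<not> saturated P (label s) (label s x) (rmem s ''bud'' 0 0) \<and> card (class_of s x) < card (class_of s' x)))"
proof -
  let ?cls = "label s" and ?\<beta> = "rmem s ''bud'' 0 0"
  let ?T = "{v \<in> P. ?cls v \<noteq> ?cls x}"
  have g: "holds_graph P s" and req: "nmem s ''req'' 0 0 = x"
    and core: "core P (insert x A) ?cls (purchase s) (g(x := \<gamma>)) ?\<beta>"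
    and gr: "growing P ?cls A g x \<gamma> ?\<beta>"
    using inv unfolding growth_inv_def by auto
  have finP: "finite P" using P finite_subset by blast
  have xn: "x < n" using P by auto
  show ?thesis
    unfolding grow_prog_def wlp_Seq
  proof (rule wlp_cons[OF wlp_search[OF g, of ?T _ "class_of s x"]], goal_cases)
    case (2 s' v)
    have "nmem s' ''pred'' = nmem s ''pred''" "nmem s' ''cls'' = nmem s ''cls''" "nmem s' ''req'' = nmem s ''req''"
      using 2(3) by (simp_all add: nw_search)
    then show ?case using 2(1,2) g req unfolding growth_test_def holds_graph_def by auto
  next
    case (4 s1)
    let ?m = "rmem s1 ''best'' 0 0" and ?q = "nmem s1 ''q'' 0 0"
    note fr1 = frame_nmem[OF 4(2), unfolded nw_search] and frr1 = frame_rmem[OF 4(2), unfolded rw_search]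
    have eq1: "nmem s1 ''cls'' = nmem s ''cls''" "nmem s1 ''req'' = nmem s ''req''" "rmem s1 ''bud'' = rmem s ''bud''"
      "nmem s1 ''buy'' = nmem s ''buy''"
      using fr1[of "''cls''"] fr1[of "''req''"] frr1[of "''bud''"] fr1[of "''buy''"] by simp_all
    have g1: "holds_graph P s1" by (rule holds_graph_frame[OF g 4(2)]) (auto simp: nw_search rw_search)
    show ?case
    proof (cases "nmem s1 ''fnd'' 0 0 \<noteq> 0 \<and> ?m < rmem s1 ''bud'' 0 0")
      case False
      have "saturated P ?cls (?cls x) ?\<beta>"
        unfolding saturated_def
      proof (intro ballI allI impI)
        fix u v F assume uv: "u \<in> P" "v \<in> P" "F \<subseteq> E" "?cls u = ?cls x" "?cls v \<noteq> ?cls x" "(u, v) \<in> conn F"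
        then have mem: "u \<in> class_of s x" "v \<in> ?T" using P by auto
        show "?\<beta> \<le> sum w F"
        proof (cases "nmem s1 ''fnd'' 0 0 = 0")
          case True
          then show ?thesis using 4(1) mem uv unfolding search_result_def by auto
        next
          case fnd: False
          then have "?m \<le> sum w F" using 4(1) mem uv(3,6) unfolding search_result_def by (simp only: if_False)
          then show ?thesis using fnd False eq1 by simp
        qed
      qed
      moreover have "growth_inv P s1 A g x \<gamma>"
        using inv g1 eq1 purchase_cong[OF eq1(4)] unfolding growth_inv_def by simp
      ultimately show ?thesis using False eq1 purchase_cong[OF eq1(4)] by auto
    next
      case True
      then have fnd: "nmem s1 ''fnd'' 0 0 \<noteq> 0" and less: "?m < ?\<beta>" using eq1 by auto
      let ?p = "path_of s1"
      have res: "?q \<in> ?T" "?p \<subseteq> E" "sum w ?p \<le> ?m" "\<exists>a\<in>class_of s x. (a, ?q) \<in> conn ?p"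
        and least: "\<And>a b F. a \<in> class_of s x \<Longrightarrow> b \<in> ?T \<Longrightarrow> F \<subseteq> E \<Longrightarrow> (a, b) \<in> conn F \<Longrightarrow> ?m \<le> sum w F"
        using 4(1) fnd unfolding search_result_def by auto
      obtain a where a: "a < n" "?cls a = ?cls x" "(a, ?q) \<in> conn ?p" using res(4) by auto
      \<comment> \<open>Classes with more than one member consist of predicted vertices, so the path
        starts in \<open>P\<close>, as \<open>growing_merge\<close> demands.\<close>
      have aP: "a \<in> P" using core a xn P unfolding core_def by (cases "a = x") auto
      have qP: "?q \<in> P" "?cls ?q \<noteq> ?cls x" using res(1) by auto
      have sat: "saturated P ?cls (?cls x) ?m"
        unfolding saturated_def using least P by auto
      \<comment> \<open>The path just found leaves the class and costs less than the budget.\<close>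
      have nsat: "\<not> saturated P ?cls (?cls x) ?\<beta>"
        using saturatedD[OF _ aP qP(1) a(2) qP(2) res(2) a(3), of ?\<beta>] res(3) less by linarith
      have m0: "0 \<le> ?m" using w_sum_nonneg[OF res(2)] res(3) by linarith
      have bv: "bval (BAnd (nz (var ''fnd'')) (RLess (rvar ''best'') (rvar ''bud''))) s1" using True by simp
      show ?thesis
        unfolding wlp_If if_P[OF bv] wlp_Seq wlp_RAssign
      proof (rule wlp_cons[OF wlp_buy_path[OF g1]], goal_cases)
        case (1 s2)
        note fr2 = frame_nmem[OF 1(2), unfolded nw_simps] and frr2 = frame_rmem[OF 1(2), unfolded nw_simps]
        have eq2: "nmem s2 ''cls'' = nmem s ''cls''" "nmem s2 ''req'' = nmem s ''req''" "nmem s2 ''q'' = nmem s1 ''q''"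
          "rmem s2 = rmem s1"
          using fr2[of "''cls''"] fr2[of "''req''"] fr2[of "''q''"] frr2 eq1 by (simp_all add: fun_eq_iff)
        have g2: "holds_graph P s2" by (rule holds_graph_frame[OF g1 1(2)]) (auto simp: nw_simps)
        let ?s2 = "s2\<lparr>rmem := upd (rmem s2) ''bud'' 0 0 (?\<beta> - ?m)\<rparr>"
        have g2': "holds_graph P ?s2" using g2 unfolding holds_graph_def by simp
        have n2: "nmem ?s2 ''n'' 0 0 = n" using g2' unfolding holds_graph_def by blast
        have "wlp relabel_prog ?s2 (\<lambda>s'. growth_inv P s' A g x \<gamma> \<and> purchase s \<subseteq> purchase s' \<and>
            card (class_of s x) < card (class_of s' x))"
        proof (rule wlp_cons[OF wlp_relabel[OF n2]], goal_cases)
          case 1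
          then show ?case using qP(2) req by (simp add: eq2)
        next
          case (2 s3)
          note fr3 = frame_nmem[OF 2(2), unfolded nw_simps] and frr3 = frame_rmem[OF 2(2), unfolded nw_simps]
          have g3: "holds_graph P s3" by (rule holds_graph_frame[OF g2' 2(2)]) (auto simp: nw_simps)
          have lab: "label s3 v = (if ?cls v = ?cls ?q then ?cls x else ?cls v)" if "v < n" for v
            using 2(1) that req by (simp add: eq2)
          have pur: "purchase s3 = purchase s \<union> ?p"
            using purchase_cong[of s3 s2] fr3[of "''buy''"] 1(1) purchase_cong[OF eq1(4)] by simp
          have req3: "nmem s3 ''req'' 0 0 = x" using fr3[of "''req''"] req eq2 by simp
          have bud: "rmem s3 ''bud'' 0 0 = ?\<beta> - ?m" using frr3[of "''bud''"] by (simp add: upd_apply)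
          have "core P (insert x A) (label s3) (purchase s3) (g(x := \<gamma>)) (?\<beta> - ?m)"
            unfolding pur by (rule core_merge[OF core P qP(1) res(2,3) a lab])
          moreover have "growing P (label s3) A g x \<gamma> (?\<beta> - ?m)"
            by (rule growing_merge[OF finP gr m0 less aP qP(1) a(2) qP(2) res(2) a(3) res(3) sat])
              (use lab P in auto)
          moreover have "card (class_of s x) < card (class_of s3 x)"
          proof (rule psubset_card_mono)
            have "?q \<in> class_of s3 x" "?q \<notin> class_of s x" "class_of s x \<subseteq> class_of s3 x"
              using lab qP P xn by auto
            then show "class_of s x \<subset> class_of s3 x" by blast
          qed simp
          ultimately show ?case using g3 req3 pur bud unfolding growth_inv_def by simp
        qed
        then have "wlp relabel_prog ?s2 (\<lambda>s'. growth_inv P s' A g x \<gamma> \<and> purchase s \<subseteq> purchase s' \<and>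
          (saturated P (label s') (label s' x) (rmem s' ''bud'' 0 0) \<or>
           \<not> saturated P ?cls (?cls x) ?\<beta> \<and> card (class_of s x) < card (class_of s' x)))"
          by (rule wlp_cons) (use nsat in blast)
        then show ?case using eq1 eq2 by simp
      qed
    qed
  qed (use P req in auto)
qed

text \<open>Here \<open>\<gamma>\<close> is the distance from the class of \<open>x\<close> to the
  earlier terminals, or 0 for the first arrival; it becomes the budget for growth.\<close>

lemma wlp_greedy:
  assumes inv: "alg_inv P s A g" and x: "nmem s ''req'' 0 0 = x" "x < n" "x \<notin> A" and P: "P \<subseteq> {..<n}"
    and con: "connects E (insert x A)"
  shows "wlp greedy_prog s (\<lambda>s'. \<exists>\<gamma>. holds_graph P s' \<and> (\<forall>v<n. nmem s' ''arr'' v 0 \<noteq> 0 \<longleftrightarrow> v \<in> insert x A) \<and>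
    nmem s' ''req'' 0 0 = x \<and> nmem s' ''cls'' = nmem s ''cls'' \<and> purchase s \<subseteq> purchase s' \<and>
    core P (insert x A) (label s') (purchase s') (g(x := \<gamma>)) \<gamma> \<and> 0 \<le> \<gamma> \<and> rmem s' ''bud'' 0 0 = \<gamma> \<and>
    (0 < \<gamma> \<longrightarrow> label s' x \<notin> label s' ` (A \<inter> P)))"
proof -
  let ?cls = "label s"
  have g: "holds_graph P s" and arr: "\<forall>v<n. nmem s ''arr'' v 0 \<noteq> 0 \<longleftrightarrow> v \<in> A"
    and core: "core P A ?cls (purchase s) g 0"
    using inv unfolding alg_inv_def by auto
  have A: "A \<subseteq> {..<n}" using core unfolding core_def by auto
  show ?thesis
    unfolding greedy_prog_def wlp_Seq
  proof (rule wlp_cons[OF wlp_search[OF g A, of _ "class_of s x"]], goal_cases)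
    case (1 s' v)
    have "nmem s' ''arr'' = nmem s ''arr''" using 1(3) by (simp add: nw_search)
    then show ?case using 1(1,2) arr unfolding terminal_test_def by auto
  next
    case (3 s1)
    let ?m = "rmem s1 ''best'' 0 0" and ?q = "nmem s1 ''q'' 0 0" and ?p = "path_of s1"
    note fr1 = frame_nmem[OF 3(2), unfolded nw_search]
    have eq1: "nmem s1 ''cls'' = nmem s ''cls''" "nmem s1 ''req'' = nmem s ''req''"
      "nmem s1 ''arr'' = nmem s ''arr''" "nmem s1 ''buy'' = nmem s ''buy''"
      using fr1[of "''cls''"] fr1[of "''req''"] fr1[of "''arr''"] fr1[of "''buy''"] by simp_all
    have g1: "holds_graph P s1" by (rule holds_graph_frame[OF g 3(2)]) (auto simp: nw_search rw_search)
    have xin: "x \<in> class_of s x" using x by simp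
    show ?case
    proof (cases "nmem s1 ''fnd'' 0 0 = 0")
      case True
      \<comment> \<open>A feasible instance connects \<open>x\<close> to all earlier terminals, so a
        failed search means that there are none.\<close>
      have A0: "A = {}"
      proof (rule ccontr)
        assume "A \<noteq> {}"
        then obtain b where "b \<in> A" by blast
        then have "(x, b) \<in> conn E" using con unfolding connects_conn by blast
        then show False using 3(1) True xin \<open>b \<in> A\<close> unfolding search_result_def by auto
      qed
      have "core P (insert x A) ?cls (purchase s \<union> {}) (g(x := 0)) 0"
        by (rule core_arrive[OF core x(2,3)]) (use A0 in auto)
      then show ?thesis
        using True eq1 g1 arr x A0 purchase_cong[OF eq1(4)]
        by (auto simp: upd_apply holds_graph_def purchase_def)
    next
      case False
      then have res: "?q \<in> A" "?p \<subseteq> E" "sum w ?p \<le> ?m" "\<exists>a\<in>class_of s x. (a, ?q) \<in> conn ?p"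
        and least: "\<And>a b F. a \<in> class_of s x \<Longrightarrow> b \<in> A \<Longrightarrow> F \<subseteq> E \<Longrightarrow> (a, b) \<in> conn F \<Longrightarrow> ?m \<le> sum w F"
        using 3(1) unfolding search_result_def by auto
      have m0: "0 \<le> ?m" using w_sum_nonneg[OF res(2)] res(3) by linarith
      have core': "core P (insert x A) ?cls (purchase s \<union> ?p) (g(x := ?m)) ?m"
        by (rule core_arrive[OF core x(2,3) m0 _ res(2,3)]) (use res least[OF xin] in auto)
      \<comment> \<open>A terminal in the class of \<open>x\<close> would be at distance 0 from that
        class, witnessed by the empty edge set.\<close>
      have unmarked: "?cls x \<notin> ?cls ` (A \<inter> P)" if "0 < ?m"
      proof
        assume "?cls x \<in> ?cls ` (A \<inter> P)"
        then obtain y where "y \<in> A" "?cls y = ?cls x" by auto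
        then have "?m \<le> sum w {}" using A by (intro least[of y y]) auto
        then show False using that by simp
      qed
      have bv: "bval (nz (var ''fnd'')) s1" using False by simp
      show ?thesis
        unfolding wlp_If if_P[OF bv] wlp_Seq wlp_RAssign wlp_NAssign
      proof (rule wlp_cons[OF wlp_buy_path[OF g1]], goal_cases)
        case (1 s2)
        note fr2 = frame_nmem[OF 1(2), unfolded nw_simps] and frr2 = frame_rmem[OF 1(2), unfolded nw_simps]
        have eq2: "nmem s2 ''cls'' = nmem s ''cls''" "nmem s2 ''req'' = nmem s ''req''" "nmem s2 ''arr'' = nmem s ''arr''"
          "rmem s2 = rmem s1"
          using fr2[of "''cls''"] fr2[of "''req''"] fr2[of "''arr''"] frr2 eq1 by (simp_all add: fun_eq_iff)
        have g2: "holds_graph P s2" by (rule holds_graph_frame[OF g1 1(2)]) (auto simp: nw_simps)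
        define r where "r = s2\<lparr>rmem := upd (rmem s2) ''bud'' 0 0 ?m, nmem := upd (nmem s2) ''arr'' x 0 (Suc 0)\<rparr>"
        have "purchase r = purchase s2" by (rule purchase_cong) (simp add: r_def)
        then have pur: "purchase r = purchase s \<union> ?p" using 1(1) purchase_cong[OF eq1(4)] by simp
        have "holds_graph P r" using g2 unfolding holds_graph_def r_def by simp
        moreover have "\<forall>v<n. nmem r ''arr'' v 0 \<noteq> 0 \<longleftrightarrow> v \<in> insert x A"
          using arr by (auto simp: upd_apply eq2 r_def)
        moreover have "nmem r ''cls'' = nmem s ''cls''" "rmem r ''bud'' 0 0 = ?m" "nmem r ''req'' 0 0 = x"
          using x by (auto simp: upd_apply eq2 r_def)
        ultimately have "holds_graph P r \<and> (\<forall>v<n. nmem r ''arr'' v 0 \<noteq> 0 \<longleftrightarrow> v \<in> insert x A) \<and>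
          nmem r ''req'' 0 0 = x \<and> nmem r ''cls'' = nmem s ''cls'' \<and> purchase s \<subseteq> purchase r \<and>
          core P (insert x A) (label r) (purchase r) (g(x := ?m)) ?m \<and> 0 \<le> ?m \<and> rmem r ''bud'' 0 0 = ?m \<and>
          (0 < ?m \<longrightarrow> label r x \<notin> label r ` (A \<inter> P))"
          using core' m0 unmarked unfolding pur by simp
        then show ?case using x unfolding r_def by (intro exI[of _ ?m]) (simp add: eq2)
      qed
    qed
  qed (use x in auto)
qed

text \<open>While unsaturated, the class has more than \<open>k\<close> vertices after
  \<open>k\<close> rounds. This starts with \<open>x\<close> itself and is impossible for
  \<open>k = n\<close>.\<close>

lemma wlp_grow_loop:
  assumes inv: "growth_inv P s A g x \<gamma>" and P: "P \<subseteq> {..<n}" "x \<in> P"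
  shows "wlp (For ''g'' grow_prog) s (\<lambda>s'. growth_inv P s' A g x \<gamma> \<and> purchase s \<subseteq> purchase s' \<and>
    saturated P (label s') (label s' x) (rmem s' ''bud'' 0 0))"
proof -
  have xn: "x < n" using P by auto
  have nwg: "nw grow_prog = {''v'', ''seen'', ''u'', ''anc'', ''k'', ''fnd'', ''a'', ''b'', ''p'', ''q'', ''par'', ''buy'', ''c'', ''cls''}"
    unfolding grow_prog_def by (auto simp: nw_search nw_simps)
  show ?thesis
  proof (rule wlp_For[where N = n and I = "\<lambda>k s'. growth_inv P s' A g x \<gamma> \<and> purchase s \<subseteq> purchase s' \<and>
      (saturated P (label s') (label s' x) (rmem s' ''bud'' 0 0) \<or> k < card (class_of s' x))"], goal_cases)
    case 4
    then show ?case using inv unfolding growth_inv_def holds_graph_def by blast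
  next
    case (5 s')
    have "card {x} \<le> card (class_of s' x)" by (rule card_mono) (use xn in auto)
    moreover have "growth_inv P s' A g x \<gamma>" "purchase s' = purchase s"
      using inv 5 unfolding growth_inv_def holds_graph_def purchase_def by simp_all
    ultimately show ?case by simp
  next
    case (6 k s')
    have upds: "growth_inv P (r\<lparr>nmem := upd (nmem r) ''g'' 0 0 c\<rparr>) A g x \<gamma> = growth_inv P r A g x \<gamma>"
      "purchase (r\<lparr>nmem := upd (nmem r) ''g'' 0 0 c\<rparr>) = purchase r" for r c
      unfolding growth_inv_def holds_graph_def purchase_def by simp_all
    have "growth_inv P s' A g x \<gamma>" using 6(2) by blast
    from wlp_grow[OF this P] show ?case
      by (rule wlp_cons) (use 6(2) in \<open>auto simp: upds\<close>)
  next
    case (7 s')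
    have "card (class_of s' x) \<le> card {..<n}" by (rule card_mono) auto
    then show ?case using 7(1) by auto
  qed (simp_all add: nwg)
qed

text \<open>A repeated request changes nothing. An unpredicted terminal forfeits its budget and
  leaves the balance as it is, since only terminals in \<open>P\<close> are counted there.\<close>

lemma wlp_serve:
  assumes inv: "alg_inv P s A g" and x: "nmem s ''req'' 0 0 = x" "x < n" and P: "P \<subseteq> {..<n}"
    and con: "connects E (insert x A)"
  shows "wlp serve_prog s (\<lambda>s'. \<exists>g'. alg_inv P s' (insert x A) g' \<and> purchase s \<subseteq> purchase s')"
proof (cases "x \<in> A")
  case True
  then have "nmem s ''arr'' x 0 \<noteq> 0" using inv x unfolding alg_inv_def by blast
  then show ?thesis using inv x True unfolding serve_prog_def by (auto simp: insert_absorb)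
next
  case False
  then have arr: "nmem s ''arr'' x 0 = 0" using inv x unfolding alg_inv_def by blast
  have bv: "\<not> bval (nz (ent ''arr'' (var ''req''))) s" using arr x by simp
  have finP: "finite P" using P finite_subset by blast
  have bal: "balanced P (label s) A g" using inv unfolding alg_inv_def by blast
  show ?thesis
    unfolding serve_prog_def wlp_If if_not_P[OF bv] wlp_Seq
  proof (rule wlp_cons[OF wlp_greedy[OF inv x False P con]], goal_cases)
    case (1 s1)
    then obtain \<gamma> where s1: "holds_graph P s1" "\<forall>v<n. nmem s1 ''arr'' v 0 \<noteq> 0 \<longleftrightarrow> v \<in> insert x A"
      "nmem s1 ''req'' 0 0 = x" "nmem s1 ''cls'' = nmem s ''cls''" "purchase s \<subseteq> purchase s1"
      "core P (insert x A) (label s1) (purchase s1) (g(x := \<gamma>)) \<gamma>" "0 \<le> \<gamma>" "rmem s1 ''bud'' 0 0 = \<gamma>"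
      "0 < \<gamma> \<Longrightarrow> label s1 x \<notin> label s1 ` (A \<inter> P)"
      by blast
    \<comment> \<open>Unspent budget may be given up when the arrival has been handled.\<close>
    have slack: "core P (insert x A) cls B h 0" if "core P (insert x A) cls B h \<beta>" "0 \<le> \<beta>" for cls B h \<beta>
      using that unfolding core_def by auto
    show ?case
    proof (cases "x \<in> P")
      case xP: False
      have "insert x A \<inter> P = A \<inter> P" using xP by auto
      moreover have "(\<Sum>y\<in>A \<inter> P. min ((g(x := \<gamma>)) y) \<delta>) = (\<Sum>y\<in>A \<inter> P. min (g y) \<delta>)" for \<delta>
        by (rule sum.cong) (use False in auto)
      ultimately have "balanced P (label s1) (insert x A) (g(x := \<gamma>))"
        using bal s1(4) unfolding balanced_def by simp
      then have "alg_inv P s1 (insert x A) (g(x := \<gamma>))"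
        using s1 slack[OF s1(6,7)] unfolding alg_inv_def by blast
      moreover have "\<not> nmem s1 ''pred'' x 0 \<noteq> 0" using s1(1) xP x(2) unfolding holds_graph_def by blast
      ultimately show ?thesis using s1(3,5) by auto
    next
      case True
      have "balanced P (label s1) A g" using bal s1(4) by simp
      then have "growing P (label s1) A g x \<gamma> \<gamma>" by (rule growing_start) (use s1 in auto)
      then have gi: "growth_inv P s1 A g x \<gamma>" using s1 unfolding growth_inv_def by simp
      have bv: "bval (nz (ent ''pred'' (var ''req''))) s1" using s1(1,3) True x(2) unfolding holds_graph_def by simp
      show ?thesis
        unfolding wlp_If if_P[OF bv]
      proof (rule wlp_cons[OF wlp_grow_loop[OF gi P True]], goal_cases)
        case (1 s2)
        have "nmem s2 ''arr'' = nmem s1 ''arr''"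
          using frame_nmem[OF 1(2), of "''arr''"] by (simp add: grow_prog_def nw_search nw_simps)
        moreover have gr: "growing P (label s2) A g x \<gamma> (rmem s2 ''bud'' 0 0)"
          using 1(1) unfolding growth_inv_def by blast
        moreover have "balanced P (label s2) (insert x A) (g(x := \<gamma>))"
          by (rule growing_finish[OF finP gr True False]) (use 1(1) in blast)
        moreover have "0 \<le> rmem s2 ''bud'' 0 0" using gr unfolding growing_def by blast
        ultimately have "alg_inv P s2 (insert x A) (g(x := \<gamma>))"
          using 1(1) s1(2) slack unfolding alg_inv_def growth_inv_def by auto
        then show ?case using 1(1) s1(5) by blast
      qed
    qed
  qed
qed


text \<open>Generalized to any memory satisfying the invariant. Each order contains all earlier
  ones, so what is owned after an arrival is the purchase read off from the current memory.\<close>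

lemma serve_sound:
  assumes "serve serve_prog s xs t Fs" "alg_inv P s A g" "set xs \<subseteq> {..<n}" "P \<subseteq> {..<n}"
    and "connects E (A \<union> set xs)"
  shows "\<exists>s' g'. alg_inv P s' (A \<union> set xs) g' \<and> purchase s' = purchase s \<union> \<Union> (set Fs) \<and>
    (\<forall>i\<le>length xs. connects (purchase s \<union> \<Union> (set (take i Fs))) (A \<union> set (take i xs)))"
  using assms
proof (induction arbitrary: A g rule: serve.induct)
  case (Nil s)
  then show ?case by (auto simp: alg_inv_def core_def connects_conn)
next
  case (Cons x s t s1 xs t' Fs)
  have "alg_inv P (arrive x s) A g"
    using Cons.prems(1) unfolding alg_inv_def arrive_def holds_graph_def purchase_def by simp
  moreover have "nmem (arrive x s) ''req'' 0 0 = x" by (simp add: arrive_def upd_apply)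
  moreover have "connects E (insert x A)" using Cons.prems(4) unfolding connects_conn by auto
  ultimately have "wlp serve_prog (arrive x s) (\<lambda>s'. \<exists>g'. alg_inv P s' (insert x A) g' \<and> purchase (arrive x s) \<subseteq> purchase s')"
    using Cons.prems(2,3) by (intro wlp_serve) auto
  with Cons.hyps(1) obtain g1 where g1: "alg_inv P s1 (insert x A) g1" "purchase (arrive x s) \<subseteq> purchase s1"
    unfolding wlp_def by blast
  have sub: "purchase s \<subseteq> purchase s1" using g1(2) by (simp add: arrive_def purchase_def)
  from Cons.IH[OF g1(1)] Cons.prems obtain s' g' where s':
    "alg_inv P s' (insert x A \<union> set xs) g'" "purchase s' = purchase s1 \<union> \<Union> (set Fs)"
    "\<forall>i\<le>length xs. connects (purchase s1 \<union> \<Union> (set (take i Fs))) (insert x A \<union> set (take i xs))"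
    by auto
  have pur: "purchase s1 = purchase s \<union> purchase s1" using sub by blast
  show ?case
  proof (intro exI conjI allI impI)
    show "alg_inv P s' (A \<union> set (x # xs)) g'" using s'(1) by simp
    show "purchase s' = purchase s \<union> \<Union> (set (purchase s1 # Fs))" using s'(2) sub by auto
    fix i assume i: "i \<le> length (x # xs)"
    show "connects (purchase s \<union> \<Union> (set (take i (purchase s1 # Fs)))) (A \<union> set (take i (x # xs)))"
    proof (cases i)
      case 0
      then show ?thesis using Cons.prems(1) by (simp add: alg_inv_def core_def connects_conn)
    next
      case (Suc j)
      have "purchase s \<union> \<Union> (set (take i (purchase s1 # Fs))) = purchase s1 \<union> \<Union> (set (take j Fs))"
        using Suc sub by auto
      moreover have "A \<union> set (take i (x # xs)) = insert x A \<union> set (take j xs)" using Suc by auto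
      ultimately show ?thesis using s'(3) i Suc by auto
    qed
  qed
qed

text \<open>Before the first arrival \<open>g\<close> is arbitrary. The labels are the identity on
  \<open>P\<close>, so the spanning costs on both sides of the balance agree.\<close>

lemma prepare_sound:
  assumes P: "P \<subseteq> {..<n}" and ex: "exec prepare_prog (input_state n E w P) t s"
  shows "alg_inv P s {} g" "purchase s = {}"
proof -
  let ?s = "input_state n E w P"
  have "wlp prepare_prog ?s (\<lambda>s'. \<forall>v<n. nmem s' ''cls'' v 0 = v)"
    unfolding prepare_prog_def
  proof (rule wlp_For[where N = n and I = "\<lambda>k s'. \<forall>v<k. nmem s' ''cls'' v 0 = v"], goal_cases)
    case (4)
    then show ?case by (simp add: input_state_def)
  qed (auto simp: upd_apply less_Suc_eq)
  then have cls: "\<forall>v<n. nmem s ''cls'' v 0 = v" using ex unfolding wlp_def by blast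
  have fr: "frame prepare_prog ?s s" using frame_exec[OF ex] .
  have eq: "nmem s a = nmem ?s a" if "a \<notin> {''v'', ''cls''}" for a
    using frame_nmem[OF fr, of a] that by (simp add: prepare_prog_def)
  have eqr: "rmem s = rmem ?s" using frame_rmem[OF fr] by (simp add: prepare_prog_def fun_eq_iff)
  show pur: "purchase s = {}"
    using eq[of "''buy''"] unfolding purchase_def by (simp add: input_state_def)
  have "holds_graph P s"
    using eq[of "''n''"] eq[of "''adj''"] eq[of "''pred''"] eqr
    unfolding holds_graph_def by (simp add: input_state_def)
  moreover have "\<forall>v<n. nmem s ''arr'' v 0 \<noteq> 0 \<longleftrightarrow> v \<in> {}"
    using eq[of "''arr''"] by (simp add: input_state_def)
  moreover have "core P {} (label s) {} g 0" using cls unfolding core_def by auto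
  moreover have "span_cost (td \<delta>) P (label s) = span_cost (td \<delta>) P id" for \<delta>
    by (rule span_cost_cong) (use cls P in auto)
  then have "balanced P (label s) {} g" unfolding balanced_def by simp
  ultimately show "alg_inv P s {} g" unfolding alg_inv_def pur by blast
qed

end

lemma steiner_alg_competitive: "competitive steiner_alg (\<lambda>\<eta>. 2 * ratio \<eta>)"
  unfolding competitive_def
proof (intro allI impI)
  fix n E w Xhat xs assume inst: "steiner_instance n E w Xhat xs"
  interpret steiner_graph n E w
    by unfold_locales (use inst in \<open>simp add: steiner_instance_def\<close>)
  have P: "Xhat \<subseteq> {..<n}" and xs: "set xs \<subseteq> {..<n}" "connects E (set xs)"
    using inst unfolding steiner_instance_def by auto
  \<comment> \<open>A run exists by the time bound; the partial correctness results then apply to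
    it.\<close>
  obtain T Fs where run: "online_run steiner_alg n E w Xhat xs T Fs"
    using steiner_alg_polynomial_time inst unfolding polynomial_time_def by blast
  then obtain s t t' where s: "exec prepare_prog (input_state n E w Xhat) t s" "serve serve_prog s xs t' Fs"
    unfolding online_run_def steiner_alg_def by auto
  note prep = prepare_sound(1)[OF P s(1), of "\<lambda>_. 0"] prepare_sound(2)[OF P s(1)]
  obtain s' g where s': "alg_inv Xhat s' (set xs) g" "purchase s' = \<Union> (set Fs)"
    "\<forall>i\<le>length xs. connects (\<Union> (set (take i Fs))) (set (take i xs))"
    using serve_sound[OF s(2) prep(1) xs(1) P, unfolded prep(2) Un_empty_left, OF xs(2)] by blast
  have core: "core Xhat (set xs) (label s') (\<Union> (set Fs)) g 0"
    and bal: "balanced Xhat (label s') (set xs) g"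
    using s' unfolding alg_inv_def by auto
  have "\<forall>F\<in>set Fs. F \<subseteq> E" using core unfolding core_def by (simp add: Sup_le_iff)
  then have feas: "feasible_purchases E xs Fs" using s'(3) unfolding feasible_purchases_def by blast
  have "sum w (\<Union> (set Fs)) \<le> 2 * sum g (set xs)" using core unfolding core_def by simp
  also have "sum g (set xs) \<le> ratio (prediction_error (set xs) Xhat) * steiner_opt E w (set xs)"
  proof (rule greedy_cost_bound[OF bal _ _ xs(2)])
    show "finite Xhat" using P finite_subset by blast
  qed (use core in \<open>simp_all add: core_def\<close>)
  finally show "\<exists>T Fs. online_run steiner_alg n E w Xhat xs T Fs \<and> feasible_purchases E xs Fs \<and>
      sum w (\<Union> (set Fs)) \<le> 2 * ratio (prediction_error (set xs) Xhat) * steiner_opt E w (set xs)"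
    using run feas by (auto simp: mult.assoc)
qed

text \<open>An asymptotic claim only: for errors 0 and 1 the logarithm vanishes while
  \<open>ratio\<close> is positive.\<close>

lemma ratio_bigo: "(\<lambda>\<eta>. 2 * ratio \<eta>) \<in> O(\<lambda>\<eta>. ln (real \<eta>))"
  unfolding ratio_def by real_asymp

theorem theorem3p12:
  "\<exists>A :: online_alg. polynomial_time A \<and>
     (\<exists>\<rho> :: nat \<Rightarrow> real. competitive A \<rho> \<and> \<rho> \<in> O(\<lambda>\<eta>. ln (real \<eta>)))"
  using steiner_alg_polynomial_time steiner_alg_competitive ratio_bigo by blast

end
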